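(* Let $P_k=\mathcal P_k(1)/\Delta_1=\{f/\Delta_1\mid f\in\mathcal P_k(1)\}$ and $d=12\Delta_1$. Then $$P_{12}=\{1\},\quad P_{16}=\{E_4\},\quad P_{18}=\{E_6\},\quad P_{20}=\{E_8\},\quad P_{22}=\{E_{10}\},\quad P_{26}=\{E_{14}\},$$ \begin{align*} P_{24}&=\big\{E_4^3-(13\pm\sqrt{144169})d\big\},\\ P_{28}&=\big\{E_4(E_4^3-9(47\pm\sqrt{18209})d)\big\},\\ P_{30}&=\big\{E_6(E_4^3+8(43\pm\sqrt{51349})d)\big\},\\ P_{32}&=\big\{E_8(E_4^3+(1567\pm\sqrt{18295489})d)\big\},\\ P_{34}&=\big\{E_{10}(E_4^3-6(851\pm\sqrt{2356201})d)\big\},\\ P_{38}&=\big\{E_{14}(E_4^3-4(2039\pm\sqrt{63737521})d)\big\}. \end{align*} Here a set written with $\pm$ consists of the two elements obtained from the two choices of sign.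
   Context: Modular forms are identified with their $q$-expansions in $\mathbb C[[q]]$. $\mathcal P_k(1)$ is the set of primitive forms of weight $k$ for $\mathrm{SL}_2(\mathbb Z)$, i.e. cusp forms of weight $k$ that are common eigenfunctions of all Hecke operators with first Fourier coefficient $1$. $E_k=1-\frac{2k}{B_k}\sum_{n\ge1}\big(\sum_{d\mid n}d^{k-1}\big)q^n$ with $B_k$ the $k$-th Bernoulli number, and $\Delta_1=\frac1{12^3}(E_4^3-E_6^2)$. *)

theory Defs
  imports
    "HOL-Complex_Analysis.Complex_Analysis"
    "HOL-Computational_Algebra.Formal_Power_Series"
begin

definition upper_half_plane :: "complex set" where
  "upper_half_plane = {z. Im z > 0}"

definition has_q_expansion :: "(complex \<Rightarrow> complex) \<Rightarrow> complex fps \<Rightarrow> bool" where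
  "has_q_expansion f F \<longleftrightarrow>
     (\<forall>z\<in>upper_half_plane. (\<lambda>n. fps_nth F n * exp (2 * of_real pi * \<i> * z) ^ n) sums f z)"

(* Modular forms for the full modular group. Only the values of f on the upper half plane are
   relevant; holomorphy at the cusp is the existence of a q-expansion without negative powers. *)
definition modular_form :: "int \<Rightarrow> (complex \<Rightarrow> complex) \<Rightarrow> bool" where
  "modular_form k f \<longleftrightarrow>
     f holomorphic_on upper_half_plane \<and>
     (\<forall>a b c d :: int. a * d - b * c = 1 \<longrightarrow>
        (\<forall>z\<in>upper_half_plane.
           f ((of_int a * z + of_int b) / (of_int c * z + of_int d)) =
             (of_int c * z + of_int d) powi k * f z)) \<and>
     (\<exists>F. has_q_expansion f F)"

definition cusp_form :: "int \<Rightarrow> (complex \<Rightarrow> complex) \<Rightarrow> bool" where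
  "cusp_form k f \<longleftrightarrow>
     modular_form k f \<and> (\<exists>F. has_q_expansion f F \<and> fps_nth F 0 = 0)"

(* The n-th Hecke operator in weight k (meaningful for n > 0):
   sum over the representatives (a b; 0 d) with a * d = n and 0 \<le> b < d. *)
definition hecke :: "int \<Rightarrow> nat \<Rightarrow> (complex \<Rightarrow> complex) \<Rightarrow> complex \<Rightarrow> complex" where
  "hecke k n f z =
     of_nat n powi (k - 1) *
     (\<Sum>d | d dvd n. \<Sum>b<d. of_nat d powi (- k) * f ((of_nat (n div d) * z + of_nat b) / of_nat d))"

definition hecke_eigenform :: "int \<Rightarrow> (complex \<Rightarrow> complex) \<Rightarrow> bool" where
  "hecke_eigenform k f \<longleftrightarrow>
     (\<forall>n>0. \<exists>ev. \<forall>z\<in>upper_half_plane. hecke k n f z = ev * f z)"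

(* The primitive forms of weight k and level 1, each identified with its q-expansion. *)
definition primitive_forms :: "int \<Rightarrow> complex fps set" where
  "primitive_forms k =
     {F. \<exists>f. cusp_form k f \<and> hecke_eigenform k f \<and> has_q_expansion f F \<and> fps_nth F 1 = 1}"

(* x / (e^x - 1) = (\<Sum>n. B_n x^n / n!) *)
definition bernoulli :: "nat \<Rightarrow> real" where
  "bernoulli n = fact n * fps_nth (fps_X / (fps_exp 1 - 1)) n"

definition Eis :: "nat \<Rightarrow> complex fps" where
  "Eis k = 1 - fps_const (of_real (2 * real k / bernoulli k)) *
             Abs_fps (\<lambda>n. if n = 0 then 0 else \<Sum>d | d dvd n. of_nat d ^ (k - 1))"

definition Delta1 :: "complex fps" where
  "Delta1 = fps_const (1 / 12 ^ 3) * (Eis 4 ^ 3 - Eis 6 ^ 2)"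

(* Delta1 has subdegree 1 and cusp forms have positive subdegree, so the division is exact. *)
definition P :: "int \<Rightarrow> complex fps set" where
  "P k = {F / Delta1 | F. F \<in> primitive_forms k}"

(* A real number as a constant q-series. *)
abbreviation rconst :: "real \<Rightarrow> complex fps" where
  "rconst x \<equiv> fps_const (complex_of_real x)"

end

theory Submission
  imports Defs
begin

text \<open>
  Everything rests on a weak form of the valence formula with an elementary proof: a modular form
  of weight \<open>k\<close> whose \<open>q\<close>-expansion starts at \<open>q\<^sup>m\<close> vanishes if \<open>k < 2 \<surd>3 \<pi> m\<close> (instead of
  \<open>k < 12 m\<close>). Since \<open>2 \<surd>3 \<pi> > 10.87\<close>, this bounds the dimensions directly in most of the weights
  in question; the weights \<open>12 m + 2\<close> and \<open>12 m - 2\<close> are reduced to it by multiplication with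
  \<open>E\<^sub>4\<close> and the relation between \<open>E\<^sub>4\<close>, \<open>E\<^sub>6\<close> and \<open>\<Delta>\<close>. Cusp forms of the given weights are
  therefore determined by their coefficients of \<open>q\<close> and possibly \<open>q\<^sup>2\<close>. In the one-dimensional case a
  normalised cusp form is automatically an eigenform; in the two-dimensional case, it is one if and
  only if \<open>a\<^sub>4 + 2\<^sup>k\<^sup>-\<^sup>1 = a\<^sub>2\<^sup>2\<close>, which is a quadratic equation for the one free parameter.
\<close>

section \<open>Modular forms and their \<open>q\<close>-expansions\<close>

text \<open>The constant 2 sqrt 3 pi has the following origin. For f = q^m h the invariant function
  |f|^2 y^k contains the factor exp(-4 pi m y) y^k, which decreases for y > k / (4 pi m), while
  every SL_2(Z)-orbit reaches y >= sqrt 3 / 2. The maximum principle thus takes the place of a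
  contour integral around the fundamental domain. Weight 12 m - 2 escapes the bound as soon as m >=
  2. Weight 12 m + 2 lies beyond even 12 m: vanishing to order m there reflects that there is no
  form of weight 2, which is why the relation between E_4, E_6 and Delta has to enter. A second
  obstacle is the normalisation: lattice sums produce Eisenstein series with an unknown constant
  term, whereas \<open>Eis\<close> is defined by Bernoulli numbers. Comparing coefficients in
  one-dimensional spaces closes this gap. That T_2 controls all T_n rests on a symmetry: the
  coefficient of q^2 in T_n F equals the coefficient of q^n in T_2 F.\<close>

definition qexp :: "complex \<Rightarrow> complex" where
  "qexp z = exp (2 * of_real pi * \<i> * z)"

lemma norm_qexp: "norm (qexp z) = exp (- 2 * pi * Im z)"
  by (simp add: qexp_def norm_exp_eq_Re)

lemma norm_qexp_less_1: "z \<in> upper_half_plane \<Longrightarrow> norm (qexp z) < 1"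
  by (simp add: norm_qexp upper_half_plane_def)

lemma qexp_surj:
  assumes "norm w = exp (- 2 * pi * y)"
  obtains z where "qexp z = w" "Im z = y"
proof -
  have w: "w \<noteq> 0" using assms by auto
  define z where "z = Ln w / (2 * of_real pi * \<i>)"
  have *: "2 * of_real pi * \<i> * z = Ln w" by (simp add: z_def)
  have z: "qexp z = w" unfolding qexp_def * using w by simp
  with norm_qexp[of z] assms have "Im z = y" by simp
  with z show ?thesis by (rule that)
qed

lemma qexp_neq_0 [simp]: "qexp z \<noteq> 0"
  by (simp add: qexp_def)

lemma qexp_add_of_int [simp]: "qexp (z + of_int n) = qexp z"
proof -
  have "2 * of_real pi * \<i> * (z + of_int n) = 2 * of_real pi * \<i> * z + 2 * of_int n * of_real pi * \<i>"
    by (simp add: algebra_simps)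
  then show ?thesis
    using exp_plus_2pin[of "2 * of_real pi * \<i> * z" n] by (simp add: qexp_def mult_ac)
qed

lemma qexp_mult_nat: "qexp (of_nat n * z) = qexp z ^ n"
  by (simp add: qexp_def mult_ac flip: exp_of_nat_mult)

text \<open>The values of q on the upper half plane meet every circle of radius in (0, 1), so
  pointwise convergence there already forces radius of convergence at least 1.\<close>

lemma has_q_expansion_iff:
  "has_q_expansion f F \<longleftrightarrow>
     fps_conv_radius F \<ge> 1 \<and> (\<forall>z\<in>upper_half_plane. f z = eval_fps F (qexp z))"
proof
  assume *: "has_q_expansion f F"
  have "fps_conv_radius F \<ge> 1"
    unfolding fps_conv_radius_def
  proof (rule conv_radius_geI_ex)
    fix r :: real assume r: "r > 0" "ereal r < 1"
    then have r1: "r < 1" by (simp flip: one_ereal_def)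
    define y where "y = - ln r / (2 * pi)"
    have y: "y > 0" "exp (- 2 * pi * y) = r"
      using r r1 by (auto simp: y_def field_simps)
    obtain z where z: "qexp z = of_real r" "Im z = y"
      using qexp_surj[of "of_real r" y] y(2) r by auto
    have "summable (\<lambda>n. fps_nth F n * qexp z ^ n)"
      using * y(1) z(2)
      unfolding has_q_expansion_def upper_half_plane_def qexp_def sums_iff by auto
    with z r show "\<exists>z. norm z = r \<and> summable (\<lambda>n. fps_nth F n * z ^ n)"
      by (intro exI[of _ "of_real r"]) auto
  qed
  then show "fps_conv_radius F \<ge> 1 \<and> (\<forall>z\<in>upper_half_plane. f z = eval_fps F (qexp z))"
    using * by (auto simp: has_q_expansion_def eval_fps_def qexp_def sums_iff)
next
  assume *: "fps_conv_radius F \<ge> 1 \<and> (\<forall>z\<in>upper_half_plane. f z = eval_fps F (qexp z))"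
  show "has_q_expansion f F"
    unfolding has_q_expansion_def
  proof
    fix z assume z: "z \<in> upper_half_plane"
    have "ereal (norm (qexp z)) < 1"
      using norm_qexp_less_1[OF z] by (simp add: one_ereal_def)
    then have "ereal (norm (qexp z)) < fps_conv_radius F"
      using * by (metis less_le_trans)
    then show "(\<lambda>n. fps_nth F n * exp (2 * of_real pi * \<i> * z) ^ n) sums f z"
      using sums_eval_fps[of "qexp z" F] * z by (simp add: qexp_def)
  qed
qed

lemma norm_qexp_less_conv_radius:
  assumes "fps_conv_radius F \<ge> 1" "z \<in> upper_half_plane"
  shows "ereal (norm (qexp z)) < fps_conv_radius F"
proof -
  have "ereal (norm (qexp z)) < 1"
    using norm_qexp_less_1[OF assms(2)] by (simp add: one_ereal_def)
  then show ?thesis using assms(1) by (metis less_le_trans)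
qed

lemma has_q_expansion_holomorphic:
  assumes "has_q_expansion f F"
  shows "f holomorphic_on upper_half_plane"
proof -
  have F: "fps_conv_radius F \<ge> 1" "\<And>z. z \<in> upper_half_plane \<Longrightarrow> f z = eval_fps F (qexp z)"
    using assms by (auto simp: has_q_expansion_iff)
  have "(eval_fps F \<circ> qexp) holomorphic_on upper_half_plane"
  proof (rule holomorphic_on_compose)
    show "qexp holomorphic_on upper_half_plane"
      unfolding qexp_def by (intro holomorphic_intros)
    show "eval_fps F holomorphic_on qexp ` upper_half_plane"
      using norm_qexp_less_conv_radius[OF F(1)]
      by (intro holomorphic_on_eval_fps) (auto simp: in_eball_iff)
  qed
  then show ?thesis
    by (rule holomorphic_transform) (simp add: F(2))
qed

text \<open>The function q never takes the value 0, so the two series agree at first on the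
  punctured disc only; continuity adds the centre, and then the identity theorem for power series
  applies.\<close>

lemma has_q_expansion_unique:
  assumes "has_q_expansion f F" "has_q_expansion f G"
  shows "F = G"
proof -
  have FG: "fps_conv_radius F \<ge> 1" "fps_conv_radius G \<ge> 1"
    "\<And>z. z \<in> upper_half_plane \<Longrightarrow> eval_fps F (qexp z) = eval_fps G (qexp z)"
    using assms by (auto simp: has_q_expansion_iff)
  have eq: "eval_fps F w = eval_fps G w" if w: "norm w < 1" "w \<noteq> 0" for w
  proof -
    define y where "y = - ln (norm w) / (2 * pi)"
    have y: "y > 0" "norm w = exp (- 2 * pi * y)"
      using w by (auto simp: y_def field_simps)
    obtain z where "qexp z = w" "Im z = y" using qexp_surj[OF y(2)] by auto
    then show ?thesis using FG(3)[of z] y by (auto simp: upper_half_plane_def)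
  qed
  have pos: "fps_conv_radius F > 0" "fps_conv_radius G > 0"
    using FG(1,2) by (auto intro: less_le_trans[of 0 1])
  have ev: "eventually (\<lambda>w. eval_fps F w = eval_fps G w) (at (0::complex))"
    unfolding eventually_at using eq by (intro exI[of _ 1]) (auto simp: dist_norm)
  have "isCont (eval_fps F) 0" "isCont (eval_fps G) 0"
    using pos by (auto intro!: continuous_on_interior[OF continuous_on_eval_fps]
        simp: interior_open in_eball_iff zero_ereal_def[symmetric])
  then have "(eval_fps F \<longlongrightarrow> eval_fps F 0) (at 0)" "(eval_fps F \<longlongrightarrow> eval_fps G 0) (at 0)"
    using ev unfolding isCont_def by (auto intro: tendsto_cong[THEN iffD2])
  then have 0: "eval_fps F 0 = eval_fps G 0"
    by (rule tendsto_unique[rotated]) simp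
  show ?thesis
  proof (rule eval_fps_eqD[OF pos])
    show "eventually (\<lambda>w. eval_fps F w = eval_fps G w) (nhds 0)"
      using eventually_nhds_conv_at ev 0 by (simp add: eventually_nhds_conv_at)
  qed
qed

lemma has_q_expansion_const: "has_q_expansion (\<lambda>_. c) (fps_const c)"
  by (simp add: has_q_expansion_iff)

lemma has_q_expansion_mult:
  assumes "has_q_expansion f F" "has_q_expansion g G"
  shows "has_q_expansion (\<lambda>z. f z * g z) (F * G)"
proof -
  have r: "fps_conv_radius F \<ge> 1" "fps_conv_radius G \<ge> 1"
    using assms by (auto simp: has_q_expansion_iff)
  then have "fps_conv_radius (F * G) \<ge> 1"
    using fps_conv_radius_mult[of F G] by (meson min.boundedI order_trans)
  moreover have "eval_fps (F * G) (qexp z) = eval_fps F (qexp z) * eval_fps G (qexp z)"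
    if "z \<in> upper_half_plane" for z
    using norm_qexp_less_conv_radius[OF _ that] r by (intro eval_fps_mult) auto
  ultimately show ?thesis using assms
    by (auto simp: has_q_expansion_iff)
qed

lemma has_q_expansion_add:
  assumes "has_q_expansion f F" "has_q_expansion g G"
  shows "has_q_expansion (\<lambda>z. f z + g z) (F + G)"
  using assms unfolding has_q_expansion_def
  by (auto simp: ring_distribs intro: sums_add)

lemma has_q_expansion_cmult:
  "has_q_expansion f F \<Longrightarrow> has_q_expansion (\<lambda>z. c * f z) (fps_const c * F)"
  by (intro has_q_expansion_mult has_q_expansion_const)

text \<open>Passing to series turns agreement of functions on the upper half plane into genuine
  equality in an integral domain, where cancellation and comparison of coefficients are
  available.\<close>

definition mf_series :: "nat \<Rightarrow> complex fps \<Rightarrow> bool" where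
  "mf_series k F \<longleftrightarrow> (\<exists>f. modular_form (int k) f \<and> has_q_expansion f F)"

lemma moebius_denominator_neq_0:
  assumes "z \<in> upper_half_plane" "(c::int, d::int) \<noteq> (0, 0)"
  shows "of_int c * z + of_int d \<noteq> 0"
proof
  assume *: "of_int c * z + of_int d = 0"
  have "Im (of_int c * z + of_int d) = of_int c * Im z" by simp
  with * assms(1) have "c = 0" by (auto simp: upper_half_plane_def)
  with * assms(2) show False by simp
qed

lemma modular_form_mult:
  assumes "modular_form k f" "modular_form l g"
  shows "modular_form (k + l) (\<lambda>z. f z * g z)"
proof -
  obtain F G where FG: "has_q_expansion f F" "has_q_expansion g G"
    using assms by (auto simp: modular_form_def)
  note q = has_q_expansion_mult[OF this]
  show ?thesis
    unfolding modular_form_def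
  proof (intro conjI allI impI ballI)
    show "(\<lambda>z. f z * g z) holomorphic_on upper_half_plane"
      by (rule has_q_expansion_holomorphic[OF q])
    show "\<exists>F. has_q_expansion (\<lambda>z. f z * g z) F" using q by blast
    fix a b c d :: int and z
    assume det: "a * d - b * c = 1" and z: "z \<in> upper_half_plane"
    have "of_int c * z + of_int d \<noteq> 0"
      by (rule moebius_denominator_neq_0[OF z]) (use det in auto)
    then show "f ((of_int a * z + of_int b) / (of_int c * z + of_int d)) *
        g ((of_int a * z + of_int b) / (of_int c * z + of_int d)) =
        (of_int c * z + of_int d) powi (k + l) * (f z * g z)"
      using assms det z by (simp add: modular_form_def power_int_add)
  qed
qed

lemma modular_form_add:
  assumes "modular_form k f" "modular_form k g"
  shows "modular_form k (\<lambda>z. f z + g z)"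
proof -
  obtain F G where FG: "has_q_expansion f F" "has_q_expansion g G"
    using assms by (auto simp: modular_form_def)
  note q = has_q_expansion_add[OF this]
  show ?thesis
    using assms has_q_expansion_holomorphic[OF q] q
    unfolding modular_form_def by (auto simp: ring_distribs)
qed

lemma modular_form_const: "modular_form 0 (\<lambda>_. c)"
  using has_q_expansion_const[of c] by (auto simp: modular_form_def)

lemma mf_series_mult:
  "mf_series k F \<Longrightarrow> mf_series l G \<Longrightarrow> mf_series (k + l) (F * G)"
  unfolding mf_series_def using modular_form_mult has_q_expansion_mult
  by (metis of_nat_add)

lemma mf_series_add:
  "mf_series k F \<Longrightarrow> mf_series k G \<Longrightarrow> mf_series k (F + G)"
  unfolding mf_series_def using modular_form_add has_q_expansion_add by metis

lemma mf_series_const: "mf_series 0 (fps_const c)"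
  unfolding mf_series_def using modular_form_const has_q_expansion_const by auto

lemma mf_series_cmult: "mf_series k F \<Longrightarrow> mf_series k (fps_const c * F)"
  using mf_series_mult[OF mf_series_const, of k F c] by simp

lemma mf_series_diff:
  "mf_series k F \<Longrightarrow> mf_series k G \<Longrightarrow> mf_series k (F - G)"
  using mf_series_add[of k F "fps_const (-1) * G"] mf_series_cmult[of k G "-1"]
  by (simp flip: fps_const_neg)

lemma mf_series_power: "mf_series k F \<Longrightarrow> mf_series (n * k) (F ^ n)"
  using mf_series_const[of 1] by (induction n) (auto intro: mf_series_mult)

section \<open>Vanishing of forms of large order\<close>

definition moebius :: "int \<Rightarrow> int \<Rightarrow> int \<Rightarrow> int \<Rightarrow> complex \<Rightarrow> complex" where
  "moebius a b c d z = (of_int a * z + of_int b) / (of_int c * z + of_int d)"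

lemma Im_moebius:
  "Im (moebius a b c d z) = of_int (a * d - b * c) * Im z / (norm (of_int c * z + of_int d))\<^sup>2"
  by (simp add: moebius_def Im_divide cmod_power2 algebra_simps)

lemma moebius_in_upper_half_plane:
  assumes "z \<in> upper_half_plane" "a * d - b * c > 0"
  shows "moebius a b c d z \<in> upper_half_plane"
proof -
  have "of_int c * z + of_int d \<noteq> 0"
    by (rule moebius_denominator_neq_0[OF assms(1)]) (use assms(2) in auto)
  moreover have "real_of_int (a * d - b * c) > 0"
    using assms(2) by (subst of_int_0_less_iff)
  ultimately show ?thesis using assms(1)
    by (auto simp: upper_half_plane_def Im_moebius)
qed

lemma norm_lattice_le_imp:
  fixes z :: complex
  assumes "norm (of_int c * z + of_int d) \<le> r" "Im z > 0"
  shows "\<bar>of_int c\<bar> \<le> r / Im z" "\<bar>of_int d\<bar> \<le> r + r / Im z * norm z"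
proof -
  have "\<bar>Im (of_int c * z + of_int d)\<bar> \<le> r"
    using assms(1) abs_Im_le_cmod by (rule order_trans[rotated])
  then have "\<bar>of_int c\<bar> * Im z \<le> r"
    using assms(2) by (simp add: abs_mult)
  then show c: "\<bar>of_int c\<bar> \<le> r / Im z"
    using assms(2) by (simp add: field_simps)
  have "norm (of_int d :: complex) \<le> norm (of_int c * z + of_int d) + norm (of_int c * z)"
    by (metis add_diff_cancel_left' add.commute norm_triangle_ineq4)
  also have "\<dots> \<le> r + r / Im z * norm z"
  proof (rule add_mono[OF assms(1)])
    have "norm (of_int c * z) = \<bar>of_int c\<bar> * norm z" by (simp add: norm_mult)
    also have "\<dots> \<le> r / Im z * norm z" by (rule mult_right_mono[OF c norm_ge_zero])
    finally show "norm (of_int c * z) \<le> r / Im z * norm z" .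
  qed
  finally show "\<bar>of_int d\<bar> \<le> r + r / Im z * norm z" by simp
qed

lemma finite_norm_lattice_le:
  fixes z :: complex
  assumes "Im z > 0"
  shows "finite {(c::int, d::int). norm (of_int c * z + of_int d) \<le> r}"
proof -
  define N where "N = \<lceil>r / Im z\<rceil> + \<lceil>r + r / Im z * norm z\<rceil> + \<bar>\<lceil>r / Im z\<rceil>\<bar> + \<bar>\<lceil>r + r / Im z * norm z\<rceil>\<bar>"
  have "\<bar>c\<bar> \<le> N \<and> \<bar>d\<bar> \<le> N" if "norm (of_int c * z + of_int d) \<le> r" for c d :: int
  proof -
    have "\<bar>c\<bar> \<le> \<lceil>r / Im z\<rceil>" "\<bar>d\<bar> \<le> \<lceil>r + r / Im z * norm z\<rceil>"
      using norm_lattice_le_imp[OF that assms] by linarith+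
    then show ?thesis unfolding N_def by linarith
  qed
  then have "{(c::int, d::int). norm (of_int c * z + of_int d) \<le> r} \<subseteq> {-N..N} \<times> {-N..N}"
    by fastforce
  then show ?thesis by (rule finite_subset) auto
qed

text \<open>A nonzero lattice vector of minimal length is the bottom row of the required matrix.\<close>

lemma fundamental_domain:
  assumes z: "z \<in> upper_half_plane"
  obtains a b c d :: int where "a * d - b * c = 1" "Im (moebius a b c d z) \<ge> sqrt 3 / 2"
proof -
  have y: "Im z > 0" using z by (simp add: upper_half_plane_def)
  let ?n = "\<lambda>(c::int, d::int). norm (of_int c * z + of_int d)"
  define A where "A = {p. ?n p \<le> 1} - {(0, 0)}"
  have "finite A"
    using finite_norm_lattice_le[OF y, of 1] by (simp add: A_def case_prod_unfold)
  moreover have "(0, 1) \<in> A" by (auto simp: A_def)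
  ultimately have "\<exists>p. is_arg_min ?n (\<lambda>p. p \<in> A) p"
    by (intro ex_is_arg_min_if_finite) auto
  then obtain p where "is_arg_min ?n (\<lambda>p. p \<in> A) p" ..
  then have p: "p \<in> A \<and> (\<forall>q. q \<in> A \<longrightarrow> ?n p \<le> ?n q)"
    unfolding is_arg_min_linorder .
  obtain c d where [simp]: "p = (c, d)" by force
  \<comment> \<open>The minimum was taken over the finite set \<open>A\<close> only. It is global
    because \<open>A\<close> contains (0, 1), of length 1, and everything outside \<open>A\<close>
    is longer than 1.\<close>
  have min: "?n (c, d) \<le> ?n q" if "q \<noteq> (0, 0)" for q
  proof (cases "?n q \<le> 1")
    case True
    then have "q \<in> A" using that by (simp add: A_def)
    then show ?thesis using p by (metis \<open>p = (c, d)\<close>)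
  next
    case False
    moreover have "?n (c, d) \<le> 1" using p by (simp add: A_def)
    ultimately show ?thesis by linarith
  qed
  have cd: "(c, d) \<noteq> (0, 0)" using p by (simp add: A_def)
  have pos: "?n (c, d) > 0" using moebius_denominator_neq_0[OF z cd] by simp
  \<comment> \<open>Otherwise dividing by the gcd would give a strictly shorter lattice
    vector.\<close>
  have "coprime c d"
  proof (rule ccontr)
    assume nc: "\<not> coprime c d"
    define g where "g = gcd c d"
    have g0: "g > 0" using cd by (auto simp: g_def)
    moreover have "g \<noteq> 1" using nc by (simp add: g_def coprime_iff_gcd_eq_1)
    ultimately have g: "g \<ge> 2" by linarith
    have eq: "c = g * (c div g)" "d = g * (d div g)" by (auto simp: g_def)
    have "(c div g, d div g) \<noteq> (0, 0)" using cd eq by auto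
    from min[OF this] have le: "?n (c, d) \<le> ?n (c div g, d div g)" .
    have "of_int c * z + of_int d = of_int g * (of_int (c div g) * z + of_int (d div g))"
      by (subst eq(1), subst eq(2)) (simp only: of_int_mult ring_distribs mult_ac)
    then have "?n (c, d) = of_int g * ?n (c div g, d div g)"
      using g0 by (simp add: norm_mult)
    moreover define X where "X = ?n (c div g, d div g)"
    ultimately have "real_of_int g * X \<le> X" "real_of_int g * X > 0"
      using le pos by simp_all
    moreover have "real_of_int g \<ge> 2" using g by simp
    ultimately have "real_of_int g * X \<le> 1 * X" "X > 0"
      using zero_less_mult_pos[of "real_of_int g" X] by linarith+
    then have "real_of_int g \<le> 1" by (metis mult_le_cancel_right_pos)
    with \<open>real_of_int g \<ge> 2\<close> show False by simp
  qed
  then obtain u v where uv: "u * c + v * d = 1"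
    by (metis bezout_int coprime_iff_gcd_eq_1)
  define w where "w = moebius v (- u) c d z"
  define n where "n = - round (Re w)"
  define a b where "a = v + n * c" and "b = - u + n * d"
  have det: "a * d - b * c = 1" using uv by (simp add: a_def b_def algebra_simps)
  have ne: "of_int c * z + of_int d \<noteq> 0" using moebius_denominator_neq_0[OF z cd] .
  have m: "moebius a b c d z = w + of_int n"
    unfolding w_def moebius_def a_def b_def using ne by (simp add: field_simps)
  have re: "\<bar>Re (moebius a b c d z)\<bar> \<le> 1 / 2"
    using of_int_round_abs_le[of "Re w"] unfolding m n_def by (simp add: abs_minus_commute)
  \<comment> \<open>The top row is a nonzero lattice vector too, so by minimality the image point
    has modulus at least 1. With real part at most 1/2 in absolute value, its imaginary part has
    square at least 3/4.\<close>
  have ab: "(a, b) \<noteq> (0, 0)" using det by auto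
  have "norm (moebius a b c d z) = ?n (a, b) / ?n (c, d)"
    by (simp add: moebius_def norm_divide)
  also have "\<dots> \<ge> 1" using min[OF ab] pos by simp
  finally have "(norm (moebius a b c d z))\<^sup>2 \<ge> 1" by (simp add: power2_eq_square mult_ge1_I)
  moreover have "(Re (moebius a b c d z))\<^sup>2 \<le> (1 / 2)\<^sup>2"
    using re by (subst abs_le_square_iff[symmetric]) simp
  ultimately have "(Im (moebius a b c d z))\<^sup>2 \<ge> 3 / 4"
    using cmod_power2[of "moebius a b c d z"] by (simp add: power_divide)
  then have "sqrt (3 / 4) \<le> \<bar>Im (moebius a b c d z)\<bar>"
    by (metis real_sqrt_abs real_sqrt_le_iff)
  moreover have "Im (moebius a b c d z) > 0"
    using moebius_in_upper_half_plane[OF z, of a d b c] det by (simp add: upper_half_plane_def)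
  ultimately have "Im (moebius a b c d z) \<ge> sqrt 3 / 2"
    by (simp add: real_sqrt_divide)
  with det show ?thesis by (rule that)
qed

text \<open>The factor |cz + d|^(2k) from the transformation law cancels against Im z / |cz + d|^2
  raised to the power k.\<close>

lemma modular_form_invariant_norm:
  assumes f: "modular_form (int k) f" and z: "z \<in> upper_half_plane" and det: "a * d - b * c = 1"
  shows "(norm (f (moebius a b c d z)))\<^sup>2 * Im (moebius a b c d z) ^ k = (norm (f z))\<^sup>2 * Im z ^ k"
proof -
  have ne: "of_int c * z + of_int d \<noteq> 0"
    by (rule moebius_denominator_neq_0[OF z]) (use det in auto)
  have "f (moebius a b c d z) = (of_int c * z + of_int d) ^ k * f z"
    using f z det by (simp add: modular_form_def moebius_def)
  with det ne show ?thesis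
    by (simp add: Im_moebius norm_mult norm_power power_mult_distrib power_divide field_simps
        flip: power_mult)
qed

text \<open>The function exp(-s t) t^k decreases for t > k / s. This follows without calculus from 1
  + x <= exp x at x = y / y1 - 1.\<close>

lemma exp_neg_mult_power_less:
  fixes s y1 y :: real
  assumes "real k < s * y1" "0 < y1" "y1 < y"
  shows "exp (- s * y) * y ^ k < exp (- s * y1) * y1 ^ k"
proof -
  have "(y / y1) ^ k \<le> exp (y / y1 - 1) ^ k"
    using assms exp_ge_add_one_self[of "y / y1 - 1"] by (intro power_mono) auto
  also have "\<dots> = exp ((real k / y1) * (y - y1))"
    using assms by (simp add: field_simps flip: exp_of_nat_mult)
  also have "\<dots> < exp (s * (y - y1))"
  proof -
    have "real k / y1 < s" using assms by (simp add: field_simps)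
    then have "real k / y1 * (y - y1) < s * (y - y1)"
      using assms by (intro mult_strict_right_mono) auto
    then show ?thesis by simp
  qed
  finally have "y ^ k < exp (s * (y - y1)) * y1 ^ k"
    using assms by (simp add: power_divide field_simps)
  then show ?thesis
    by (simp add: right_diff_distrib exp_diff exp_minus field_simps)
qed

text \<open>
  Write \<open>f = q\<^sup>m h\<close>. By the maximum principle for \<open>h\<close>, the invariant function
  \<open>\<bar>f\<bar>\<^sup>2 y\<^sup>k\<close> is strictly smaller at all points with \<open>Im z \<ge> \<surd>3/2\<close> than its maximum over a
  slightly lower horizontal line. But the point where that maximum is attained is
  equivalent to a point with \<open>Im z \<ge> \<surd>3/2\<close>.
\<close>

lemma mf_series_vanish_bound:
  assumes F: "mf_series k F" and low: "\<And>n. n < m \<Longrightarrow> fps_nth F n = 0"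
    and k: "real k < 2 * sqrt 3 * pi * real m"
  shows "F = 0"
proof -
  obtain f where f: "modular_form (int k) f" "has_q_expansion f F"
    using F by (auto simp: mf_series_def)
  have m: "m > 0" using k by (cases m) auto
  define h where "h = fps_shift m F"
  have Fh: "F = fps_X ^ m * h"
  proof (rule fps_ext)
    show "fps_nth F n = fps_nth (fps_X ^ m * h) n" for n
      using low[of n] by (simp add: h_def fps_X_power_mult_nth)
  qed
  have rF: "fps_conv_radius F \<ge> 1" using f(2) by (simp add: has_q_expansion_iff)
  then have rh: "fps_conv_radius h \<ge> 1" by (simp add: h_def fps_conv_radius_shift)
  have in_r: "ereal (norm w) < fps_conv_radius h" if "norm w < 1" for w
    using less_le_trans[OF _ rh] that by (simp add: one_ereal_def)
  have fz: "f z = qexp z ^ m * eval_fps h (qexp z)" if z: "z \<in> upper_half_plane" for z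
  proof -
    have "f z = eval_fps (fps_X ^ m * h) (qexp z)"
      using f(2) z Fh by (auto simp: has_q_expansion_iff)
    also have "\<dots> = qexp z ^ m * eval_fps h (qexp z)"
      using in_r[OF norm_qexp_less_1[OF z]]
      by (subst eval_fps_mult) (auto simp: eval_fps_power)
    finally show ?thesis .
  qed
  define s where "s = 4 * pi * real m"
  have s: "s > 0" using m by (simp add: s_def)
  have phi: "(norm (f z))\<^sup>2 * Im z ^ k = exp (- s * Im z) * Im z ^ k * (norm (eval_fps h (qexp z)))\<^sup>2"
    if "z \<in> upper_half_plane" for z
  proof -
    have "(norm (qexp z ^ m))\<^sup>2 = exp (- s * Im z)"
      by (simp add: norm_power norm_qexp s_def flip: exp_of_nat_mult power_mult)
    then show ?thesis by (simp add: fz[OF that] norm_mult power_mult_distrib)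
  qed
  have "real k / s < sqrt 3 / 2"
    using k s m by (simp add: s_def field_simps)
  then have "max 0 (real k / s) < sqrt 3 / 2" by (simp only: max_less_iff_conj) simp
  \<comment> \<open>Above k / s, so that exp(-s y) y^k decreases from \<open>y1\<close> on; below
    sqrt 3 / 2, so that the equivalent point \<open>z2\<close> lies strictly higher than
    \<open>z1\<close>. The 0 keeps \<open>y1\<close> positive when k = 0.\<close>
  then obtain y1 where y1: "max 0 (real k / s) < y1" "y1 < sqrt 3 / 2"
    using dense by blast
  have y1': "y1 > 0" "real k < s * y1"
    using y1(1) s unfolding max_less_iff_conj by (simp_all add: field_simps)
  define r where "r = exp (- 2 * pi * y1)"
  have r: "0 < r" "r < 1" using y1' by (auto simp: r_def)
  have sub: "(cball 0 r :: complex set) \<subseteq> eball 0 (fps_conv_radius h)"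
  proof
    fix w :: complex assume "w \<in> cball 0 r"
    then show "w \<in> eball 0 (fps_conv_radius h)"
      using in_r[of w] r by (simp add: in_eball_iff)
  qed
  have cont: "continuous_on (cball 0 r) (eval_fps h)"
    by (rule continuous_on_subset[OF continuous_on_eval_fps sub])
  have "compact (sphere 0 r :: complex set)" "sphere 0 r \<noteq> ({} :: complex set)"
    using r by auto
  moreover have "continuous_on (sphere 0 r) (\<lambda>w. norm (eval_fps h w))"
    by (intro continuous_on_norm continuous_on_subset[OF cont]) auto
  ultimately obtain w1 where w1: "w1 \<in> sphere 0 r"
    "\<And>w. w \<in> sphere 0 r \<Longrightarrow> norm (eval_fps h w) \<le> norm (eval_fps h w1)"
    using continuous_attains_sup[of "sphere 0 r" "\<lambda>w. norm (eval_fps h w)"] by blast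
  define R where "R = norm (eval_fps h w1)"
  have maxR: "norm (eval_fps h w) \<le> R" if "norm w \<le> r" for w
  proof (rule maximum_modulus_frontier[of "eval_fps h" "cball 0 r"])
    show "eval_fps h holomorphic_on interior (cball 0 r)"
      using sub interior_subset by (intro holomorphic_on_eval_fps) blast
  qed (use cont w1 that r in \<open>auto simp: R_def\<close>)
  obtain z1 where z1: "qexp z1 = w1" "Im z1 = y1"
    using qexp_surj[of w1 y1] w1(1) by (auto simp: r_def)
  have z1H: "z1 \<in> upper_half_plane" using z1 y1' by (simp add: upper_half_plane_def)
  obtain a b c d :: int where det: "a * d - b * c = 1"
    and im: "Im (moebius a b c d z1) \<ge> sqrt 3 / 2"
    by (rule fundamental_domain[OF z1H])
  define z2 where "z2 = moebius a b c d z1"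
  have z2: "z2 \<in> upper_half_plane" "Im z2 > y1"
    using moebius_in_upper_half_plane[OF z1H, of a d b c] det im y1 by (auto simp: z2_def)
  have "norm (qexp z2) \<le> r"
    using z2(2) by (simp add: norm_qexp r_def)
  then have R2: "norm (eval_fps h (qexp z2)) \<le> R" by (rule maxR)
  have "R = 0"
  proof (rule ccontr)
    assume "R \<noteq> 0"
    then have R: "R > 0" by (simp add: R_def)
    have "exp (- s * y1) * y1 ^ k * R\<^sup>2 = (norm (f z1))\<^sup>2 * Im z1 ^ k"
      unfolding phi[OF z1H] by (simp add: z1 R_def)
    also have "\<dots> = (norm (f z2))\<^sup>2 * Im z2 ^ k"
      using modular_form_invariant_norm[OF f(1) z1H det] by (simp add: z2_def)
    also have "\<dots> = exp (- s * Im z2) * Im z2 ^ k * (norm (eval_fps h (qexp z2)))\<^sup>2"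
      by (rule phi[OF z2(1)])
    also have "\<dots> \<le> exp (- s * Im z2) * Im z2 ^ k * R\<^sup>2"
      using R2 z2 y1' by (intro mult_left_mono power_mono) auto
    also have "\<dots> < exp (- s * y1) * y1 ^ k * R\<^sup>2"
      using exp_neg_mult_power_less[OF y1'(2,1) z2(2)] R by simp
    finally show False by simp
  qed
  have "h = 0"
  proof (rule eval_fps_eqD)
    show "fps_conv_radius h > 0" using less_le_trans[OF _ rh, of 0] by simp
    show "eventually (\<lambda>w. eval_fps h w = eval_fps 0 w) (nhds 0)"
      using maxR r unfolding \<open>R = 0\<close> eventually_nhds_metric
      by (intro exI[of _ r]) auto
  qed simp
  then show ?thesis by (simp add: Fh)
qed

text \<open>The precision matters: the most demanding use is weight 76 with order 7, which requires
  a constant above 76/7 = 10.857....\<close>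

lemma sqrt_3_pi_gt: "2 * sqrt 3 * pi > 10.87"
proof -
  have "sqrt 3 > 1.732" by (rule real_less_rsqrt) (simp add: power2_eq_square)
  moreover have "pi > 3.14" using pi_approx(1) by simp
  ultimately have "1.732 * 3.14 < sqrt 3 * pi" by (intro mult_strict_mono) auto
  then show ?thesis by simp
qed

corollary mf_series_vanish_bound':
  assumes "mf_series k F" "\<And>n. n < m \<Longrightarrow> fps_nth F n = 0" "real k < 10.87 * real m"
  shows "F = 0"
proof (rule mf_series_vanish_bound[OF assms(1,2)])
  have "m > 0" using assms(3) by (cases m) auto
  then have "10.87 * real m < 2 * sqrt 3 * pi * real m"
    using sqrt_3_pi_gt by (intro mult_strict_right_mono) auto
  with assms(3) show "real k < 2 * sqrt 3 * pi * real m" by linarith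
qed

section \<open>The Lipschitz formula\<close>

text \<open>Induction by the operator q d/dq, which multiplies the m-th coefficient by m and does
  not shrink the radius of convergence.\<close>

lemma conv_radius_powers: "fps_conv_radius (Abs_fps (\<lambda>m. of_nat m ^ j :: complex)) \<ge> 1"
proof (induction j)
  case 0
  have "conv_radius (\<lambda>_. 1 :: complex) \<ge> 1"
  proof (rule conv_radius_geI_ex)
    fix r :: real assume "r > 0" "ereal r < 1"
    then show "\<exists>z. norm z = r \<and> summable (\<lambda>n. 1 * z ^ n :: complex)"
      by (intro exI[of _ "of_real r"]) (auto simp: one_ereal_def intro!: summable_geometric)
  qed
  then show ?case by (simp add: fps_conv_radius_def)
next
  case (Suc j)
  let ?F = "Abs_fps (\<lambda>m. of_nat m ^ j :: complex)"
  have "Abs_fps (\<lambda>m. of_nat m ^ Suc j :: complex) = fps_X * fps_deriv ?F"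
    by (rule fps_ext) (simp add: of_nat_diff)
  moreover have "fps_conv_radius (fps_X * fps_deriv ?F) \<ge> min \<infinity> (fps_conv_radius (fps_deriv ?F))"
    using fps_conv_radius_mult[of fps_X "fps_deriv ?F"] by simp
  moreover have "fps_conv_radius (fps_deriv ?F) \<ge> 1"
    using Suc fps_conv_radius_deriv[of ?F] by (rule order_trans)
  ultimately show ?case by simp
qed

text \<open>The polylogarithm sum of m^j q^m. For j = 0 the term m = 0 counts as 1, so the value is
  1 / (1 - q).\<close>

definition qpow :: "nat \<Rightarrow> complex \<Rightarrow> complex" where
  "qpow j z = eval_fps (Abs_fps (\<lambda>m. of_nat m ^ j)) (qexp z)"

lemma qexp_has_field_derivative:
  "(qexp has_field_derivative (2 * of_real pi * \<i> * qexp z)) (at z within A)"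
  unfolding qexp_def by (auto intro!: derivative_eq_intros)

lemma qpow_has_field_derivative:
  assumes z: "z \<in> upper_half_plane"
  shows "(qpow j has_field_derivative (2 * of_real pi * \<i> * qpow (Suc j) z)) (at z within A)"
proof -
  let ?F = "Abs_fps (\<lambda>m. of_nat m ^ j :: complex)"
  note r = norm_qexp_less_conv_radius[OF conv_radius_powers z]
  have eq: "Abs_fps (\<lambda>m. of_nat m ^ Suc j :: complex) = fps_X * fps_deriv ?F"
    by (rule fps_ext) (simp add: of_nat_diff)
  have "ereal (norm (qexp z)) < fps_conv_radius (fps_deriv ?F)"
    using r[of j] fps_conv_radius_deriv[of ?F] by (rule less_le_trans)
  then have "qpow (Suc j) z = qexp z * eval_fps (fps_deriv ?F) (qexp z)"
    unfolding qpow_def eq by (subst eval_fps_mult) auto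
  moreover have "(eval_fps ?F \<circ> qexp has_field_derivative
      eval_fps (fps_deriv ?F) (qexp z) * (2 * of_real pi * \<i> * qexp z)) (at z within A)"
    by (rule DERIV_image_chain[OF has_field_derivative_eval_fps[OF r] qexp_has_field_derivative])
  moreover have "eval_fps ?F \<circ> qexp = qpow j"
    by (simp add: fun_eq_iff qpow_def)
  ultimately show ?thesis by (simp add: mult_ac)
qed

lemma qpow_0:
  assumes "z \<in> upper_half_plane"
  shows "qpow 0 z = 1 / (1 - qexp z)"
  using suminf_geometric[OF norm_qexp_less_1[OF assms]]
  by (simp add: qpow_def eval_fps_def)

lemma upper_half_plane_not_int:
  assumes "z \<in> upper_half_plane"
  shows "z \<notin> \<int>\<^sub>\<le>\<^sub>0" "1 - z \<notin> \<int>\<^sub>\<le>\<^sub>0"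
proof -
  have "Im w = 0" if "w \<in> \<int>\<^sub>\<le>\<^sub>0" for w
    using that nonpos_Ints_Int Ints_cases by (metis complex_Im_of_int)
  with assms show "z \<notin> \<int>\<^sub>\<le>\<^sub>0" "1 - z \<notin> \<int>\<^sub>\<le>\<^sub>0"
    by (fastforce simp: upper_half_plane_def)+
qed

lemma open_upper_half_plane: "open upper_half_plane"
  unfolding upper_half_plane_def by (rule open_halfspace_Im_gt)

lemma one_minus_compose_has_field_derivative:
  assumes "\<And>w. w \<in> S \<Longrightarrow> (f has_field_derivative f' w) (at w)" "1 - z \<in> S"
  shows "((\<lambda>z. f (1 - z)) has_field_derivative (- f' (1 - z :: complex))) (at z)"
proof -
  have "((\<lambda>z. f (1 - z)) has_field_derivative (f' (1 - z) * - 1)) (at z)"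
    by (rule DERIV_chain2[of f "f' (1 - z)" "\<lambda>z. 1 - z", OF assms(1)[OF assms(2)]])
       (auto intro!: derivative_eq_intros)
  then show ?thesis by simp
qed

lemma sin_pi_neq_0:
  assumes "z \<in> upper_half_plane"
  shows "sin (of_real pi * z) \<noteq> 0"
proof
  assume "sin (of_real pi * z) = 0"
  then obtain n :: int where "of_real pi * z = of_real (of_int n * pi)"
    by (auto simp: sin_eq_0)
  then have "Im (of_real pi * z) = 0" by simp
  with assms show False by (simp add: upper_half_plane_def)
qed

text \<open>Logarithmic derivative of Gamma(z) Gamma(1 - z) = pi / sin(pi z).\<close>

lemma Digamma_reflection:
  assumes z: "z \<in> upper_half_plane"
  shows "Digamma z - Digamma (1 - z) = - of_real pi * cos (of_real pi * z) / sin (of_real pi * z)"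
proof -
  let ?s = "sin (of_real pi * z)" and ?c = "cos (of_real pi * z)"
  note n = upper_half_plane_not_int[OF z] and s = sin_pi_neq_0[OF z]
  have "((\<lambda>z. Gamma (1 - z)) has_field_derivative (- (Gamma (1 - z) * Digamma (1 - z)))) (at z)"
    by (rule one_minus_compose_has_field_derivative[of "- \<int>\<^sub>\<le>\<^sub>0"])
       (use n in \<open>auto intro: has_field_derivative_Gamma\<close>)
  then have "((\<lambda>z. Gamma z * Gamma (1 - z)) has_field_derivative
      (Gamma z * Digamma z) * Gamma (1 - z) + - (Gamma (1 - z) * Digamma (1 - z)) * Gamma z) (at z)"
    by (rule DERIV_mult[OF has_field_derivative_Gamma[OF n(1)]])
  moreover have "((\<lambda>z. Gamma z * Gamma (1 - z)) has_field_derivative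
      (- (of_real pi * (of_real pi * ?c)) / (?s * ?s))) (at z)"
    unfolding Gamma_reflection_complex
    using s by (auto intro!: derivative_eq_intros)
  ultimately have "(Gamma z * Digamma z) * Gamma (1 - z) + - (Gamma (1 - z) * Digamma (1 - z)) * Gamma z
      = - (of_real pi * (of_real pi * ?c)) / (?s * ?s)"
    by (rule DERIV_unique)
  then have "(Gamma z * Gamma (1 - z)) * (Digamma z - Digamma (1 - z)) =
      - (of_real pi * (of_real pi * ?c)) / (?s * ?s)"
    by (simp add: algebra_simps)
  also have "\<dots> = (of_real pi / ?s) * (- of_real pi * ?c / ?s)" by simp
  finally have "(of_real pi / ?s) * (Digamma z - Digamma (1 - z)) = (of_real pi / ?s) * (- of_real pi * ?c / ?s)"
    unfolding Gamma_reflection_complex .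
  then show ?thesis
    by (subst (asm) mult_cancel_left) (use s in auto)
qed

text \<open>Both sides are - pi cot(pi z). Its expression in q is computed with the square root
  \<open>e\<close> = exp(i pi z) of q.\<close>

lemma Polygamma_reflection_qpow_0:
  assumes z: "z \<in> upper_half_plane"
  shows "Polygamma 0 z - Polygamma 0 (1 - z) = of_real pi * \<i> * (2 * qpow 0 z - 1)"
proof -
  define e where "e = exp (\<i> * (of_real pi * z))"
  have e0: "e \<noteq> 0" by (simp add: e_def)
  have q: "qexp z = e * e" by (simp add: e_def qexp_def mult_ac flip: exp_add)
  have "norm (qexp z) < 1" by (rule norm_qexp_less_1[OF z])
  then have ne: "e * e \<noteq> 1" using q by auto
  have s: "sin (of_real pi * z) = (e - 1 / e) / (2 * \<i>)"
    by (simp add: sin_exp_eq e_def exp_minus inverse_eq_divide)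
  have c: "cos (of_real pi * z) = (e + 1 / e) / 2"
    by (simp add: cos_exp_eq e_def exp_minus inverse_eq_divide)
  have "cos (of_real pi * z) / sin (of_real pi * z) = \<i> * (e * e + 1) / (e * e - 1)"
    unfolding s c using e0 ne by (simp add: field_simps)
  moreover have "2 * qpow 0 z - 1 = - ((e * e + 1) / (e * e - 1))"
    unfolding qpow_0[OF z] q using ne by (simp add: field_simps)
  ultimately show ?thesis
    unfolding Digamma_reflection[OF z] by (simp flip: times_divide_eq_right)
qed

lemma Polygamma_reflection_has_field_derivative:
  assumes z: "z \<in> upper_half_plane"
  shows "((\<lambda>z. Polygamma j z - (-1) ^ j * Polygamma j (1 - z)) has_field_derivative
           (Polygamma (Suc j) z - (-1) ^ Suc j * Polygamma (Suc j) (1 - z))) (at z)"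
proof -
  note n = upper_half_plane_not_int[OF z]
  have "((\<lambda>z. Polygamma j (1 - z)) has_field_derivative (- Polygamma (Suc j) (1 - z))) (at z)"
    by (rule one_minus_compose_has_field_derivative[of "- \<int>\<^sub>\<le>\<^sub>0"])
       (use n in \<open>auto intro: has_field_derivative_Polygamma\<close>)
  from DERIV_diff[OF has_field_derivative_Polygamma[OF n(1), of j] DERIV_cmult[OF this, of "(-1) ^ j"]]
  show ?thesis by simp
qed

text \<open>Repeated differentiation of \<open>Polygamma_reflection_qpow_0\<close>. Each derivative
  brings a factor 2 pi i and flips the sign of the reflected term; the first one removes the
  constant -1, hence the start at order 1.\<close>

lemma Polygamma_reflection_qpow:
  assumes "z \<in> upper_half_plane"
  shows "Polygamma (Suc j) z - (-1) ^ Suc j * Polygamma (Suc j) (1 - z) =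
           (2 * of_real pi * \<i>) ^ Suc (Suc j) * qpow (Suc j) z"
  using assms
proof (induction j arbitrary: z)
  case 0
  have "((\<lambda>z. of_real pi * \<i> * (2 * qpow 0 z - 1)) has_field_derivative
      (2 * of_real pi * \<i>) ^ 2 * qpow 1 z) (at z)"
    using qpow_has_field_derivative[OF 0, of 0]
    by (auto intro!: derivative_eq_intros simp: power2_eq_square)
  moreover have "((\<lambda>z. of_real pi * \<i> * (2 * qpow 0 z - 1)) has_field_derivative
      (Polygamma 1 z - (-1) ^ 1 * Polygamma 1 (1 - z))) (at z)"
  proof (rule has_field_derivative_transform_within_open[OF _ open_upper_half_plane 0])
    show "((\<lambda>z. Polygamma 0 z - (-1) ^ 0 * Polygamma 0 (1 - z)) has_field_derivative
        (Polygamma 1 z - (-1) ^ 1 * Polygamma 1 (1 - z))) (at z)"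
      using Polygamma_reflection_has_field_derivative[OF 0, of 0] unfolding One_nat_def .
    show "Polygamma 0 w - (-1) ^ 0 * Polygamma 0 (1 - w) = of_real pi * \<i> * (2 * qpow 0 w - 1)"
      if "w \<in> upper_half_plane" for w
      unfolding power_0 mult_1 by (rule Polygamma_reflection_qpow_0[OF that])
  qed
  ultimately show ?case
    using DERIV_unique by (fastforce simp: numeral_2_eq_2)
next
  case (Suc j)
  have "((\<lambda>z. (2 * of_real pi * \<i>) ^ Suc (Suc j) * qpow (Suc j) z) has_field_derivative
      (2 * of_real pi * \<i>) ^ Suc (Suc (Suc j)) * qpow (Suc (Suc j)) z) (at z)"
    using DERIV_cmult[OF qpow_has_field_derivative[OF Suc.prems], of "(2 * of_real pi * \<i>) ^ Suc (Suc j)" "Suc j"]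
    by (simp add: mult_ac)
  moreover have "((\<lambda>z. (2 * of_real pi * \<i>) ^ Suc (Suc j) * qpow (Suc j) z) has_field_derivative
      (Polygamma (Suc (Suc j)) z - (-1) ^ Suc (Suc j) * Polygamma (Suc (Suc j)) (1 - z))) (at z)"
    by (rule has_field_derivative_transform_within_open[OF
          Polygamma_reflection_has_field_derivative[OF Suc.prems] open_upper_half_plane Suc.prems])
       (rule Suc.IH)
  ultimately show ?case by (rule DERIV_unique[symmetric])
qed

lemma sums_inverse_power_shift:
  assumes "z \<in> upper_half_plane" "even k" "k > 0"
  shows "(\<lambda>n. inverse ((z + of_nat n) ^ k)) sums (Polygamma (k - 1) z / fact (k - 1))"
        "(\<lambda>n. inverse ((1 - z + of_nat n) ^ k)) sums (Polygamma (k - 1) (1 - z) / fact (k - 1))"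
proof -
  have ne: "z \<noteq> 0" "1 - z \<noteq> 0" using assms(1) by (auto simp: upper_half_plane_def)
  obtain j where k: "k = Suc j" "j > 0" "odd j"
    using assms(2,3) by (cases k) (auto intro: Nat.gr0I)
  show "(\<lambda>n. inverse ((z + of_nat n) ^ k)) sums (Polygamma (k - 1) z / fact (k - 1))"
    "(\<lambda>n. inverse ((1 - z + of_nat n) ^ k)) sums (Polygamma (k - 1) (1 - z) / fact (k - 1))"
    using Polygamma_LIMSEQ[OF ne(1) k(2)] Polygamma_LIMSEQ[OF ne(2) k(2)] k(3)
    by (simp_all add: k(1))
qed

text \<open>The terms d >= 0 sum to a polygamma value at z, the terms d < 0 to one at 1 - z because
  k is even, and the reflection formula combines the two. Unconditional summability over the
  integers is assumed here; it is later inherited from the rows of the lattice sum.\<close>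

lemma Lipschitz_formula:
  assumes z: "z \<in> upper_half_plane" and k: "even k" "k > 0"
    and summ: "(\<lambda>d::int. inverse ((z + of_int d) ^ k)) summable_on UNIV"
  shows "((\<lambda>d::int. inverse ((z + of_int d) ^ k)) has_sum
           ((2 * of_real pi * \<i>) ^ k / fact (k - 1) * qpow (k - 1) z)) UNIV"
proof -
  let ?f = "\<lambda>d::int. inverse ((z + of_int d) ^ k)"
  obtain j where j: "k = Suc (Suc j)" "even j"
    using k by (metis even_Suc gr0_conv_Suc odd_pos)
  have 1: "(?f has_sum (Polygamma (k - 1) z / fact (k - 1))) (range int)"
  proof -
    have "?f summable_on range int" using summ by (rule summable_on_subset) auto
    then obtain s where s: "(?f has_sum s) (range int)" by (auto simp: summable_on_def)
    then have "((\<lambda>n. ?f (int n)) has_sum s) UNIV"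
      by (subst (asm) has_sum_reindex) (auto simp: o_def)
    then have "(\<lambda>n. inverse ((z + of_nat n) ^ k)) sums s"
      by (auto dest: has_sum_imp_sums)
    then have "s = Polygamma (k - 1) z / fact (k - 1)"
      using sums_inverse_power_shift(1)[OF z k] by (rule sums_unique2)
    with s show ?thesis by simp
  qed
  have 2: "(?f has_sum (Polygamma (k - 1) (1 - z) / fact (k - 1))) (range (\<lambda>n. - int n - 1))"
  proof -
    have "?f summable_on range (\<lambda>n. - int n - 1)" using summ by (rule summable_on_subset) auto
    then obtain s where s: "(?f has_sum s) (range (\<lambda>n. - int n - 1))" by (auto simp: summable_on_def)
    have eq: "?f (- int n - 1) = inverse ((1 - z + of_nat n) ^ k)" for n
    proof -
      have "z + of_int (- int n - 1) = - (1 - z + of_nat n)" by simp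
      then show ?thesis using k(1) by (metis power_minus_even)
    qed
    have "inj (\<lambda>n. - int n - 1)" by (auto intro: injI)
    with s have "((\<lambda>n. ?f (- int n - 1)) has_sum s) UNIV"
      by (subst (asm) has_sum_reindex) (auto simp: o_def)
    then have "(\<lambda>n. inverse ((1 - z + of_nat n) ^ k)) sums s"
      unfolding eq by (rule has_sum_imp_sums)
    then have "s = Polygamma (k - 1) (1 - z) / fact (k - 1)"
      using sums_inverse_power_shift(2)[OF z k] by (rule sums_unique2)
    with s show ?thesis by simp
  qed
  have un: "range int \<union> range (\<lambda>n. - int n - 1) = UNIV"
  proof -
    have "d \<in> range int \<union> range (\<lambda>n. - int n - 1)" for d
    proof (cases "d \<ge> 0")
      case True
      then have "d = int (nat d)" by simp
      then show ?thesis by blast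
    next
      case False
      then have "d = - int (nat (- d - 1)) - 1" by simp
      then show ?thesis by blast
    qed
    then show ?thesis by blast
  qed
  have "(?f has_sum (Polygamma (k - 1) z / fact (k - 1) + Polygamma (k - 1) (1 - z) / fact (k - 1))) UNIV"
    unfolding un[symmetric] by (rule has_sum_Un_disjoint[OF 1 2]) auto
  moreover have "Polygamma (k - 1) z + Polygamma (k - 1) (1 - z) = (2 * of_real pi * \<i>) ^ k * qpow (k - 1) z"
    using Polygamma_reflection_qpow[OF z, of j] j by simp
  ultimately show ?thesis
    by (simp flip: add_divide_distrib)
qed

section \<open>Eisenstein series\<close>

lemma inverse_one_plus_square_summable_on_int:
  "(\<lambda>c::int. inverse (1 + (of_int c)\<^sup>2 :: real)) summable_on UNIV"
proof -
  let ?f = "\<lambda>c::int. inverse (1 + (of_int c)\<^sup>2 :: real)"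
  have "summable (\<lambda>n. inverse (1 + (of_nat n)\<^sup>2 :: real))"
  proof (rule summable_comparison_test_ev[OF _ inverse_power_summable[of 2]])
    show "\<forall>\<^sub>F n in sequentially. norm (inverse (1 + (of_nat n)\<^sup>2 :: real)) \<le> inverse (of_nat n ^ 2)"
      using eventually_gt_at_top[of 0]
      by eventually_elim (auto intro!: le_imp_inverse_le)
  qed simp
  then have s: "(\<lambda>n. inverse (1 + (of_nat n)\<^sup>2 :: real)) summable_on UNIV"
    by (subst summable_on_UNIV_nonneg_real_iff) auto
  have "?f summable_on range int" "?f summable_on range (\<lambda>n. - int n)"
    using s by (subst summable_on_reindex; auto simp: inj_on_def o_def)+
  then have "?f summable_on (range int \<union> range (\<lambda>n. - int n))"
    by (rule summable_on_union)
  moreover have "range int \<union> range (\<lambda>n. - int n) = UNIV"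
    by (auto simp: image_iff) (metis int_cases2)
  ultimately show ?thesis by simp
qed

text \<open>Taking r = |cz + d| in \<open>norm_lattice_le_imp\<close> bounds |c| and |d| by
  multiples of r that depend only on z.\<close>

lemma norm_lattice_lower_bound:
  assumes "z \<in> upper_half_plane"
  shows "\<exists>K>0. \<forall>c d :: int. (of_int c)\<^sup>2 + (of_int d)\<^sup>2 \<le> K * (norm (of_int c * z + of_int d))\<^sup>2"
proof -
  have y: "Im z > 0" using assms by (simp add: upper_half_plane_def)
  define K where "K = (1 / Im z)\<^sup>2 + (1 + norm z / Im z)\<^sup>2"
  have "K > 0" using y unfolding K_def by (intro add_pos_nonneg) auto
  moreover have "(of_int c)\<^sup>2 + (of_int d)\<^sup>2 \<le> K * (norm (of_int c * z + of_int d))\<^sup>2" for c d :: int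
  proof -
    define r where "r = norm (of_int c * z + of_int d)"
    have "\<bar>of_int c\<bar> \<le> r * (1 / Im z)" "\<bar>of_int d\<bar> \<le> r * (1 + norm z / Im z)"
      using norm_lattice_le_imp[of c z d r] y by (auto simp: r_def algebra_simps)
    then have "(of_int c)\<^sup>2 \<le> (r * (1 / Im z))\<^sup>2" "(of_int d)\<^sup>2 \<le> (r * (1 + norm z / Im z))\<^sup>2"
      by (metis abs_ge_zero power2_abs power_mono)+
    then show ?thesis
      unfolding r_def[symmetric] K_def power_mult_distrib
      by (simp add: ring_distribs mult_ac)
  qed
  ultimately show ?thesis by blast
qed

abbreviation lattice0 :: "(int \<times> int) set" where
  "lattice0 \<equiv> UNIV - {(0, 0)}"

text \<open>Comparison with the product of two convergent one-variable sums of 1 / (1 + c^2). That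
  product is bounded by a multiple of |cz + d|^4, hence the requirement k >= 4.\<close>

lemma eisenstein_abs_summable:
  assumes z: "z \<in> upper_half_plane" and k: "k \<ge> 4"
  shows "(\<lambda>(c, d). norm (inverse ((of_int c * z + of_int d) ^ k))) summable_on lattice0"
proof -
  obtain K :: real where K: "K > 0"
    "\<And>c d :: int. (of_int c)\<^sup>2 + (of_int d)\<^sup>2 \<le> K * (norm (of_int c * z + of_int d))\<^sup>2"
    using norm_lattice_lower_bound[OF z] by auto
  let ?g = "\<lambda>c::int. inverse (1 + (of_int c)\<^sup>2 :: real)"
  \<comment> \<open>The part 3 K^2 comes from 1 + N + N^2 <= 3 N^2 and N <= K r^2 with N = c^2 +
    d^2. The remaining k - 4 powers of r are supplied by the factor sqrt K r >= 1.\<close>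
  define M where "M = 3 * K\<^sup>2 * sqrt K ^ (k - 4)"
  have "(\<lambda>(c, d). ?g c * ?g d) summable_on UNIV \<times> UNIV"
  proof (rule summable_on_SigmaI[where g = "\<lambda>c. ?g c * infsum ?g UNIV"])
    show "((\<lambda>d. case (c, d) of (c, d) \<Rightarrow> ?g c * ?g d) has_sum ?g c * infsum ?g UNIV) UNIV" for c
      unfolding prod.case
      by (intro has_sum_cmult_right has_sum_infsum inverse_one_plus_square_summable_on_int)
    show "(\<lambda>c. ?g c * infsum ?g UNIV) summable_on UNIV"
      by (intro summable_on_cmult_left inverse_one_plus_square_summable_on_int)
  qed auto
  then have "(\<lambda>(c, d). ?g c * ?g d) summable_on lattice0"
    by (rule summable_on_subset) simp
  then have "(\<lambda>p. M * (case p of (c, d) \<Rightarrow> ?g c * ?g d)) summable_on lattice0"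
    by (rule summable_on_cmult_right)
  then have "(\<lambda>p. norm (case p of (c, d) \<Rightarrow> inverse ((of_int c * z + of_int d) ^ k))) summable_on lattice0"
  proof (rule Infinite_Sum.abs_summable_on_comparison_test')
    fix p :: "int \<times> int" assume p0: "p \<in> lattice0"
    obtain c d where p: "p = (c, d)" by force
    with p0 have ne: "(c, d) \<noteq> (0, 0)" by simp
    define r where "r = norm (of_int c * z + of_int d)"
    have r: "r > 0" using moebius_denominator_neq_0[OF z ne] by (simp add: r_def)
    define N where "N = ((of_int c)\<^sup>2 + (of_int d)\<^sup>2 :: real)"
    have N: "N \<le> K * r\<^sup>2" unfolding N_def r_def by (rule K(2))
    have "c\<^sup>2 + d\<^sup>2 > 0" using ne by (simp add: sum_power2_gt_zero_iff)
    then have "real_of_int (c\<^sup>2 + d\<^sup>2) \<ge> 1" by linarith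
    then have N1: "N \<ge> 1" unfolding N_def by simp
    have "(1 + (of_int c)\<^sup>2) * (1 + (of_int d)\<^sup>2) = 1 + N + (of_int c)\<^sup>2 * (of_int d)\<^sup>2"
      by (simp add: N_def algebra_simps)
    also have "(of_int c)\<^sup>2 * (of_int d)\<^sup>2 \<le> N * N"
      unfolding N_def by (intro mult_mono) auto
    also have "1 + N + N * N \<le> 3 * (N * N)"
    proof -
      have "N * 1 \<le> N * N" using N1 by (intro mult_left_mono) auto
      with N1 show ?thesis by linarith
    qed
    also have "N * N \<le> (K * r\<^sup>2) * (K * r\<^sup>2)"
      using N N1 by (intro mult_mono) auto
    also have "3 * ((K * r\<^sup>2) * (K * r\<^sup>2)) = 3 * K\<^sup>2 * r ^ 4"
      by (simp add: power2_eq_square power4_eq_xxxx mult_ac)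
    finally have 1: "(1 + (of_int c)\<^sup>2) * (1 + (of_int d)\<^sup>2) \<le> 3 * K\<^sup>2 * r ^ 4"
      by simp
    have "1 \<le> K * r\<^sup>2" using N N1 by simp
    then have "sqrt 1 \<le> sqrt (K * r\<^sup>2)" by (rule real_sqrt_le_mono)
    then have "1 \<le> sqrt K * r" using r by (simp add: real_sqrt_mult)
    then have "1 \<le> (sqrt K * r) ^ (k - 4)" by (rule one_le_power)
    from mult_mono[OF 1 this]
    have "(1 + (of_int c)\<^sup>2) * (1 + (of_int d)\<^sup>2) * 1 \<le> (3 * K\<^sup>2 * r ^ 4) * (sqrt K * r) ^ (k - 4)"
      by simp
    also have "\<dots> = M * r ^ k"
      using k by (simp add: M_def power_mult_distrib mult_ac flip: power_add)
    finally have "(1 + (of_int c)\<^sup>2) * (1 + (of_int d)\<^sup>2) \<le> M * r ^ k" by simp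
    moreover have "(1 + (of_int c)\<^sup>2 :: real) * (1 + (of_int d)\<^sup>2) > 0"
      by (intro mult_pos_pos add_pos_nonneg) auto
    ultimately have "inverse (r ^ k) \<le> M * inverse ((1 + (of_int c)\<^sup>2) * (1 + (of_int d)\<^sup>2))"
      using r by (simp add: divide_simps)
    then show "norm (case p of (c, d) \<Rightarrow> inverse ((of_int c * z + of_int d) ^ k))
        \<le> M * (case p of (c, d) \<Rightarrow> ?g c * ?g d)"
      by (simp add: p r_def norm_inverse norm_power)
  qed
  then show ?thesis by (simp only: case_prod_unfold)
qed

definition eisenstein_sum :: "nat \<Rightarrow> complex \<Rightarrow> complex" where
  "eisenstein_sum k z = (\<Sum>\<^sub>\<infinity>(c, d)\<in>lattice0. inverse ((of_int c * z + of_int d) ^ k))"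

lemma eisenstein_summable:
  assumes "z \<in> upper_half_plane" "k \<ge> 4"
  shows "(\<lambda>(c, d). inverse ((of_int c * z + of_int d) ^ k)) summable_on lattice0"
  using eisenstein_abs_summable[OF assms] abs_summable_summable
  by (simp only: case_prod_unfold)

text \<open>Right multiplication of the row (m, n) by the matrix permutes the nonzero lattice
  vectors; \<open>?h'\<close> is multiplication by the inverse matrix.\<close>

lemma eisenstein_sum_moebius:
  assumes z: "z \<in> upper_half_plane" and det: "a * d - b * c = 1"
  shows "eisenstein_sum k (moebius a b c d z) = (of_int c * z + of_int d) ^ k * eisenstein_sum k z"
proof -
  have ne: "of_int c * z + of_int d \<noteq> 0"
    by (rule moebius_denominator_neq_0[OF z]) (use det in auto)
  let ?h = "\<lambda>(m, n). (m * a + n * c, m * b + n * d)"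
  let ?h' = "\<lambda>(m, n). (m * d - n * c, - m * b + n * a)"
  have inv: "?h' (?h p) = p" "?h (?h' p) = p" for p
  proof -
    obtain m n where [simp]: "p = (m, n)" by force
    have "m * (a * d - b * c) = m" "n * (a * d - b * c) = n" using det by simp_all
    then show "?h' (?h p) = p" "?h (?h' p) = p" by (auto simp: algebra_simps)
  qed
  have bij: "bij_betw ?h lattice0 lattice0"
  proof (rule bij_betwI[where g = ?h'])
    have "?h p = (0, 0) \<longleftrightarrow> p = (0, 0)" for p
      using inv(1)[of p] by auto
    then show "?h \<in> lattice0 \<rightarrow> lattice0" by auto
    have "?h' p = (0, 0) \<longleftrightarrow> p = (0, 0)" for p
      using inv(2)[of p] by auto
    then show "?h' \<in> lattice0 \<rightarrow> lattice0" by auto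
  qed (use inv in auto)
  have "eisenstein_sum k (moebius a b c d z) =
      (\<Sum>\<^sub>\<infinity>p\<in>lattice0. (of_int c * z + of_int d) ^ k *
         (case ?h p of (m, n) \<Rightarrow> inverse ((of_int m * z + of_int n) ^ k)))"
    unfolding eisenstein_sum_def
  proof (rule infsum_cong)
    fix p :: "int \<times> int"
    obtain m n where p: "p = (m, n)" by force
    have "of_int m * moebius a b c d z + of_int n =
        (of_int (m * a + n * c) * z + of_int (m * b + n * d)) / (of_int c * z + of_int d)"
      using ne by (simp add: moebius_def field_simps)
    then show "(case p of (m, n) \<Rightarrow> inverse ((of_int m * moebius a b c d z + of_int n) ^ k)) =
        (of_int c * z + of_int d) ^ k * (case ?h p of (m, n) \<Rightarrow>
           inverse ((of_int m * z + of_int n) ^ k))"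
      by (simp only: p power_divide prod.case inverse_divide) (simp add: divide_inverse)
  qed
  also have "\<dots> = (of_int c * z + of_int d) ^ k *
      (\<Sum>\<^sub>\<infinity>p\<in>lattice0. (case ?h p of (m, n) \<Rightarrow> inverse ((of_int m * z + of_int n) ^ k)))"
    by (rule infsum_cmult_right')
  also have "(\<Sum>\<^sub>\<infinity>p\<in>lattice0. (case ?h p of (m, n) \<Rightarrow> inverse ((of_int m * z + of_int n) ^ k))) =
      eisenstein_sum k z"
    unfolding eisenstein_sum_def by (rule infsum_reindex_bij_betw[OF bij])
  finally show ?thesis .
qed

section \<open>Divisor sums, Lambert series and the Fourier expansion of the Eisenstein
  series\<close>

definition sigma_series :: "nat \<Rightarrow> complex fps" where
  "sigma_series j = Abs_fps (\<lambda>n. if n = 0 then 0 else \<Sum>d | d dvd n. of_nat d ^ j)"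

lemma norm_sigma_series_le:
  "norm (fps_nth (sigma_series j) n) \<le> real n ^ Suc j"
proof (cases "n = 0")
  case False
  have "norm (\<Sum>d | d dvd n. (of_nat d ^ j :: complex)) \<le> (\<Sum>d | d dvd n. real n ^ j)"
    using False by (intro sum_norm_le) (auto simp: norm_power intro!: power_mono dvd_imp_le)
  also have "\<dots> = real (card {d. d dvd n}) * real n ^ j" by simp
  also have "card {d. d dvd n} \<le> card {1..n}"
    using False by (intro card_mono) (auto simp: Suc_le_eq dvd_imp_le intro: dvd_pos_nat)
  then have "real (card {d. d dvd n}) * real n ^ j \<le> real n * real n ^ j"
    by (intro mult_right_mono) auto
  finally show ?thesis using False by (simp add: sigma_series_def)
qed (simp add: sigma_series_def)

lemma powers_summable_norm:
  assumes "norm (w :: complex) < 1"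
  shows "summable (\<lambda>n. real n ^ j * norm w ^ n)"
proof -
  have "ereal (norm w) < fps_conv_radius (Abs_fps (\<lambda>m. of_nat m ^ j :: complex))"
    using assms by (intro less_le_trans[OF _ conv_radius_powers]) (simp add: one_ereal_def)
  from norm_summable_fps[OF this] show ?thesis by (simp add: norm_mult norm_power)
qed

lemma sigma_series_summable_norm:
  assumes "norm (w :: complex) < 1"
  shows "summable (\<lambda>n. norm (fps_nth (sigma_series j) n * w ^ n))"
  using norm_sigma_series_le
  by (intro summable_comparison_test[OF _ powers_summable_norm[OF assms, of "Suc j"]])
     (auto simp: norm_mult norm_power intro!: mult_right_mono simp del: power_Suc)

lemma fps_conv_radius_sigma_series: "fps_conv_radius (sigma_series j) \<ge> 1"
  unfolding fps_conv_radius_def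
proof (rule conv_radius_geI_ex)
  fix r :: real assume r: "r > 0" "ereal r < 1"
  then show "\<exists>z. norm z = r \<and> summable (\<lambda>n. fps_nth (sigma_series j) n * z ^ n)"
    by (intro exI[of _ "of_real r"])
       (auto simp: one_ereal_def intro!: summable_norm_cancel[OF sigma_series_summable_norm])
qed

text \<open>The Lambert series: both sides enumerate the pairs \<open>(c, m)\<close> of positive integers,
  on the right-hand side grouped by the product \<open>n = c m\<close>.\<close>

lemma lambert_has_sum:
  assumes w: "norm (w :: complex) < 1"
  shows "((\<lambda>(c, m). of_nat m ^ j * w ^ (c * m)) has_sum eval_fps (sigma_series j) w) ({1..} \<times> {1..})"
proof -
  let ?f = "\<lambda>(n, m). of_nat m ^ j * w ^ n"
  let ?S = "Sigma {1..} (\<lambda>n. {m. m dvd n})"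
  have fin: "finite {m. m dvd n}" if "n \<in> {1..}" for n :: nat using that by auto
  have row: "((\<lambda>m. of_nat m ^ j * w ^ n) has_sum (fps_nth (sigma_series j) n * w ^ n)) {m. m dvd n}"
    if n: "n \<in> {1..}" for n
    by (rule has_sum_finiteI[OF fin[OF n]]) (use n in \<open>simp add: sigma_series_def sum_distrib_right\<close>)
  have rown: "((\<lambda>m. norm (of_nat m ^ j * w ^ n)) has_sum norm (fps_nth (sigma_series j) n * w ^ n)) {m. m dvd n}"
    if n: "n \<in> {1..}" for n
  proof (rule has_sum_finiteI[OF fin[OF n]])
    have "fps_nth (sigma_series j) n = of_real (\<Sum>m | m dvd n. real m ^ j)"
      using n by (simp add: sigma_series_def)
    then have "norm (fps_nth (sigma_series j) n) = (\<Sum>m | m dvd n. real m ^ j)"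
      by (simp only: norm_of_real) (simp add: sum_nonneg)
    then show "norm (fps_nth (sigma_series j) n * w ^ n) = (\<Sum>m | m dvd n. norm (of_nat m ^ j * w ^ n))"
      by (simp add: norm_mult norm_power sum_distrib_right)
  qed
  have "(\<lambda>n. norm (fps_nth (sigma_series j) n * w ^ n)) summable_on {1..}"
  proof (rule summable_on_subset)
    show "(\<lambda>n. norm (fps_nth (sigma_series j) n * w ^ n)) summable_on UNIV"
      using sigma_series_summable_norm[OF w, of j]
      by (subst summable_on_UNIV_nonneg_real_iff) simp_all
  qed simp
  then have "(\<lambda>(n, m). norm (of_nat m ^ j * w ^ n)) summable_on ?S"
    by (intro summable_on_SigmaI[where g = "\<lambda>n. norm (fps_nth (sigma_series j) n * w ^ n)"]) (use rown in auto)
  then have "(\<lambda>p. norm (?f p)) summable_on ?S"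
    by (simp only: case_prod_unfold)
  then have summ: "?f summable_on ?S"
    by (rule abs_summable_summable)
  have "((\<lambda>n. fps_nth (sigma_series j) n * w ^ n) has_sum eval_fps (sigma_series j) w) UNIV"
    unfolding eval_fps_def
    by (intro norm_summable_imp_has_sum sigma_series_summable_norm[OF w]
        summable_sums summable_norm_cancel[OF sigma_series_summable_norm[OF w]])
  then have "((\<lambda>n. fps_nth (sigma_series j) n * w ^ n) has_sum eval_fps (sigma_series j) w) {1..}"
    by (rule has_sum_cong_neutral[THEN iffD1, rotated -1]) (auto simp: sigma_series_def not_le)
  then have "(?f has_sum eval_fps (sigma_series j) w) ?S"
    by (intro has_sum_SigmaI[OF _ _ summ]) (use row in auto)
  moreover have "((\<lambda>(c, m). of_nat m ^ j * w ^ (c * m)) has_sum eval_fps (sigma_series j) w) ({1..} \<times> {1..}) \<longleftrightarrow>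
      (?f has_sum eval_fps (sigma_series j) w) ?S"
    by (rule has_sum_reindex_bij_witness[of _ "\<lambda>(n, m). (n div m, m)" "\<lambda>(c, m). (c * m, m)"])
       (auto simp: Suc_le_eq dvd_div_eq_0_iff intro: dvd_pos_nat)
  ultimately show ?thesis by simp
qed

lemma qpow_has_sum:
  assumes z: "z \<in> upper_half_plane" and j: "j > 0"
  shows "((\<lambda>m. of_nat m ^ j * qexp z ^ m) has_sum qpow j z) {1..}"
proof -
  have summ: "summable (\<lambda>n. norm (of_nat n ^ j * qexp z ^ n))"
    using powers_summable_norm[OF norm_qexp_less_1[OF z], of j] by (simp add: norm_mult norm_power)
  have "((\<lambda>m. of_nat m ^ j * qexp z ^ m) has_sum qpow j z) UNIV"
    unfolding qpow_def eval_fps_def fps_nth_Abs_fps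
    by (intro norm_summable_imp_has_sum summ summable_sums summable_norm_cancel[OF summ])
  then show ?thesis
    by (rule has_sum_cong_neutral[THEN iffD1, rotated -1]) (use j in \<open>auto simp: not_le\<close>)
qed

lemma qpow_mult_has_sum:
  assumes z: "z \<in> upper_half_plane" and j: "j > 0"
  shows "((\<lambda>c. qpow j (of_nat c * z)) has_sum eval_fps (sigma_series j) (qexp z)) {1..}"
proof (rule has_sum_SigmaD[OF lambert_has_sum[OF norm_qexp_less_1[OF z]]])
  fix c :: nat assume "c \<in> {1..}"
  then have "of_nat c * z \<in> upper_half_plane" using z by (simp add: upper_half_plane_def)
  from qpow_has_sum[OF this j]
  show "((\<lambda>m. case (c, m) of (c, m) \<Rightarrow> of_nat m ^ j * qexp z ^ (c * m)) has_sum qpow j (of_nat c * z)) {1..}"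
    by (simp add: qexp_mult_nat power_mult)
qed

text \<open>Row c is the Lipschitz formula at the point c z; summing the rows over c >= 1 gives the
  Lambert series.\<close>

lemma eisenstein_positive_rows:
  assumes z: "z \<in> upper_half_plane" and k: "even k" "k \<ge> 4"
  shows "((\<lambda>(c, d). inverse ((of_int c * z + of_int d) ^ k)) has_sum
    ((2 * of_real pi * \<i>) ^ k / fact (k - 1) * eval_fps (sigma_series (k - 1)) (qexp z))) ({1..} \<times> UNIV)"
proof -
  let ?F = "\<lambda>(c, d). inverse ((of_int c * z + of_int d) ^ k)"
  let ?F' = "\<lambda>(c, d). inverse ((of_nat c * z + of_int d) ^ k)"
  let ?C = "(2 * of_real pi * \<i>) ^ k / fact (k - 1) :: complex"
  have "?F summable_on {1..} \<times> UNIV"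
    using eisenstein_summable[OF z k(2)] by (rule summable_on_subset) auto
  then obtain s where s: "(?F has_sum s) ({1..} \<times> UNIV)"
    by (auto simp: summable_on_def)
  have "(?F has_sum s) ({1..} \<times> UNIV) \<longleftrightarrow> (?F' has_sum s) ({1..} \<times> UNIV)"
    by (rule has_sum_reindex_bij_witness[of _ "\<lambda>(c, d). (int c, d)" "\<lambda>(c, d). (nat c, d)"])
       (auto simp flip: of_nat_nat)
  with s have s': "(?F' has_sum s) ({1..} \<times> UNIV)" by simp
  have "((\<lambda>c. ?C * qpow (k - 1) (of_nat c * z)) has_sum s) {1..}"
  proof (rule has_sum_SigmaD[OF s'])
    fix c :: nat assume c: "c \<in> {1..}"
    then have cz: "of_nat c * z \<in> upper_half_plane" using z by (simp add: upper_half_plane_def)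
    have "(\<lambda>d::int. inverse ((of_nat c * z + of_int d) ^ k)) summable_on UNIV"
      using summable_on_SigmaD1[of "\<lambda>c d. inverse ((of_nat c * z + of_int d) ^ k)" "{1..}" "\<lambda>_. UNIV"] s' c
      by (auto simp: summable_on_def)
    from Lipschitz_formula[OF cz k(1) _ this] k(2)
    show "((\<lambda>d. ?F' (c, d)) has_sum ?C * qpow (k - 1) (of_nat c * z)) UNIV" by simp
  qed
  moreover have "((\<lambda>c. ?C * qpow (k - 1) (of_nat c * z)) has_sum
      (?C * eval_fps (sigma_series (k - 1)) (qexp z))) {1..}"
    by (intro has_sum_cmult_right qpow_mult_has_sum z) (use k in simp)
  ultimately have "s = ?C * eval_fps (sigma_series (k - 1)) (qexp z)"
    by (rule has_sum_unique)
  with s show ?thesis by simp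
qed

text \<open>The rows c < 0 repeat the rows c > 0 under (c, d) -> (-c, -d), as k is even. The row c =
  0, which is 2 zeta(k), is left unevaluated.\<close>

lemma eisenstein_sum_eq:
  assumes z: "z \<in> upper_half_plane" and k: "even k" "k \<ge> 4"
  shows "eisenstein_sum k z = (\<Sum>\<^sub>\<infinity>(c, d)\<in>{0::int} \<times> (UNIV - {0}). inverse (of_int d ^ k)) +
    2 * ((2 * of_real pi * \<i>) ^ k / fact (k - 1)) * eval_fps (sigma_series (k - 1)) (qexp z)"
proof -
  let ?F = "\<lambda>(c::int, d::int). inverse ((of_int c * z + of_int d) ^ k)"
  let ?S = "(2 * of_real pi * \<i>) ^ k / fact (k - 1) * eval_fps (sigma_series (k - 1)) (qexp z)"
  let ?Z = "\<Sum>\<^sub>\<infinity>(c, d)\<in>{0::int} \<times> (UNIV - {0}). inverse (of_int d ^ k) :: complex"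
  have "?F summable_on {0} \<times> (UNIV - {0})"
    using eisenstein_summable[OF z k(2)] by (rule summable_on_subset) auto
  then have "(?F has_sum infsum ?F ({0} \<times> (UNIV - {0}))) ({0} \<times> (UNIV - {0}))"
    by (rule has_sum_infsum)
  also have "infsum ?F ({0} \<times> (UNIV - {0})) = ?Z"
    by (rule infsum_cong) auto
  finally have 0: "(?F has_sum ?Z) ({0} \<times> (UNIV - {0}))" .
  have 1: "(?F has_sum ?S) ({1..} \<times> UNIV)"
    by (rule eisenstein_positive_rows[OF assms])
  have "(?F has_sum ?S) ({1..} \<times> UNIV) \<longleftrightarrow> (?F has_sum ?S) ({..-1} \<times> UNIV)"
  proof (rule has_sum_reindex_bij_witness[of _ "\<lambda>(c, d). (- c, - d)" "\<lambda>(c, d). (- c, - d)"])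
    fix p :: "int \<times> int"
    obtain c d where p: "p = (c, d)" by force
    have "of_int (- c) * z + of_int (- d) = - (of_int c * z + of_int d)" by simp
    then have "(of_int (- c) * z + of_int (- d)) ^ k = (of_int c * z + of_int d) ^ k"
      using k(1) by (metis power_minus_even)
    then show "?F (case p of (c, d) \<Rightarrow> (- c, - d)) = ?F p" by (simp only: p prod.case)
  qed auto
  with 1 have 2: "(?F has_sum ?S) ({..-1} \<times> UNIV)" by simp
  have "(?F has_sum (?Z + ?S)) ({0} \<times> (UNIV - {0}) \<union> {1..} \<times> UNIV)"
    by (rule has_sum_Un_disjoint[OF 0 1]) auto
  then have "(?F has_sum (?Z + ?S + ?S)) ({0} \<times> (UNIV - {0}) \<union> {1..} \<times> UNIV \<union> {..-1} \<times> UNIV)"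
    by (rule has_sum_Un_disjoint[OF _ 2]) auto
  also have "{0} \<times> (UNIV - {0}) \<union> {1..} \<times> UNIV \<union> {..-1} \<times> UNIV = lattice0"
    by auto
  finally have "eisenstein_sum k z = ?Z + ?S + ?S"
    unfolding eisenstein_sum_def by (rule infsumI)
  then show ?thesis by (simp add: mult_ac)
qed

text \<open>Dividing by \<open>C\<close> makes the nonconstant part an explicit divisor sum. The
  constant term is a zeta value divided by \<open>C\<close>; it stays existential and is determined
  algebraically later.\<close>

lemma mf_series_eisenstein:
  assumes k: "even k" "k \<ge> 4"
  shows "\<exists>a. mf_series k (fps_const a + sigma_series (k - 1))"
proof -
  define C where "C = 2 * ((2 * of_real pi * \<i>) ^ k / fact (k - 1) :: complex)"
  define Z where "Z = (\<Sum>\<^sub>\<infinity>(c, d)\<in>{0::int} \<times> (UNIV - {0}). inverse (of_int d ^ k) :: complex)"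
  have C: "C \<noteq> 0" by (simp add: C_def)
  define f where "f = (\<lambda>z. eisenstein_sum k z / C)"
  have "has_q_expansion f (fps_const (Z / C) + sigma_series (k - 1))"
    unfolding has_q_expansion_iff
  proof (intro conjI ballI)
    let ?F = "fps_const (Z / C) + sigma_series (k - 1)"
    show "fps_conv_radius ?F \<ge> 1"
      using fps_conv_radius_add[of "fps_const (Z / C)" "sigma_series (k - 1)"]
        fps_conv_radius_sigma_series[of "k - 1"] by simp
    fix z assume z: "z \<in> upper_half_plane"
    have "eisenstein_sum k z = Z + C * eval_fps (sigma_series (k - 1)) (qexp z)"
      unfolding Z_def C_def by (rule eisenstein_sum_eq[OF z k])
    then have "f z = Z / C + eval_fps (sigma_series (k - 1)) (qexp z)"
      unfolding f_def using C by (simp add: add_divide_distrib)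
    also have "\<dots> = eval_fps ?F (qexp z)"
      using norm_qexp_less_conv_radius[OF fps_conv_radius_sigma_series z]
      by (subst eval_fps_add) auto
    finally show "f z = eval_fps ?F (qexp z)" .
  qed
  moreover from this have "modular_form (int k) f"
    unfolding modular_form_def
    using has_q_expansion_holomorphic eisenstein_sum_moebius
    by (auto simp: f_def moebius_def)
  ultimately show ?thesis unfolding mf_series_def by blast
qed

section \<open>Hecke operators\<close>

type_synonym mat2 = "int \<times> int \<times> int \<times> int"

fun mmult :: "mat2 \<Rightarrow> mat2 \<Rightarrow> mat2" where
  "mmult (a, b, c, d) (a', b', c', d') = (a * a' + b * c', a * b' + b * d', c * a' + d * c', c * b' + d * d')"

fun mdet :: "mat2 \<Rightarrow> int" where
  "mdet (a, b, c, d) = a * d - b * c"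

fun madj :: "mat2 \<Rightarrow> mat2" where
  "madj (a, b, c, d) = (d, - b, - c, a)"

fun mact :: "mat2 \<Rightarrow> complex \<Rightarrow> complex" where
  "mact (a, b, c, d) z = moebius a b c d z"

fun mfac :: "mat2 \<Rightarrow> complex \<Rightarrow> complex" where
  "mfac (a, b, c, d) z = of_int c * z + of_int d"

lemma mmult_assoc: "mmult (mmult L M) N = mmult L (mmult M N)"
  by (cases L; cases M; cases N) (simp add: algebra_simps)

lemma mdet_mmult: "mdet (mmult M N) = mdet M * mdet N"
  by (cases M; cases N) (simp add: algebra_simps)

lemma mdet_madj [simp]: "mdet (madj M) = mdet M"
  by (cases M) (simp add: algebra_simps)

lemma mmult_one [simp]: "mmult (1, 0, 0, 1) M = M" "mmult M (1, 0, 0, 1) = M"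
  by (cases M; simp)+

lemma mmult_madj: "mdet M = 1 \<Longrightarrow> mmult M (madj M) = (1, 0, 0, 1)" "mdet M = 1 \<Longrightarrow> mmult (madj M) M = (1, 0, 0, 1)"
  by (cases M; simp add: algebra_simps)+

lemma mfac_neq_0: "z \<in> upper_half_plane \<Longrightarrow> mdet M > 0 \<Longrightarrow> mfac M z \<noteq> 0"
proof -
  assume z: "z \<in> upper_half_plane" and det: "mdet M > 0"
  obtain a b c d where M: "M = (a, b, c, d)" by (metis prod_cases4)
  have "of_int c * z + of_int d \<noteq> 0"
    by (rule moebius_denominator_neq_0[OF z]) (use det in \<open>auto simp: M\<close>)
  then show ?thesis by (simp add: M)
qed

lemma mact_in_upper_half_plane: "z \<in> upper_half_plane \<Longrightarrow> mdet M > 0 \<Longrightarrow> mact M z \<in> upper_half_plane"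
  by (cases M) (simp add: moebius_in_upper_half_plane)

lemma mfac_mmult:
  assumes "z \<in> upper_half_plane" "mdet N > 0"
  shows "mfac (mmult M N) z = mfac M (mact N z) * mfac N z"
  using mfac_neq_0[OF assms] by (cases M; cases N) (simp add: moebius_def field_simps)

lemma mact_mmult:
  assumes "z \<in> upper_half_plane" "mdet N > 0" "mdet M > 0"
  shows "mact (mmult M N) z = mact M (mact N z)"
proof -
  have "mfac M (mact N z) \<noteq> 0"
    by (intro mfac_neq_0 mact_in_upper_half_plane assms)
  with mfac_neq_0[OF assms(1,2)] show ?thesis
    by (cases M; cases N) (simp add: moebius_def divide_simps, simp add: algebra_simps)
qed

lemma modular_form_mact:
  assumes "modular_form k f" "z \<in> upper_half_plane" "mdet M = 1"
  shows "f (mact M z) = mfac M z powi k * f z"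
  using assms by (cases M) (simp add: modular_form_def moebius_def)

text \<open>These pairs index upper triangular representatives of the integral matrices of
  determinant n modulo left multiplication by SL_2(Z); \<open>exists_hecke_mat\<close> and
  \<open>hecke_mat_unique\<close> prove that they form a full set.\<close>

definition hecke_index :: "nat \<Rightarrow> (nat \<times> nat) set" where
  "hecke_index n = Sigma {d. d dvd n} (\<lambda>d. {..<d})"

fun hecke_mat :: "nat \<Rightarrow> nat \<times> nat \<Rightarrow> mat2" where
  "hecke_mat n (d, b) = (int (n div d), int b, 0, int d)"

lemma finite_hecke_index: "n > 0 \<Longrightarrow> finite (hecke_index n)"
  unfolding hecke_index_def by (intro finite_SigmaI) auto

lemma mdet_hecke_mat: "p \<in> hecke_index n \<Longrightarrow> mdet (hecke_mat n p) = int n"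
  by (cases p) (auto simp: hecke_index_def simp flip: of_nat_mult)

lemma hecke_eq_sum_mact:
  assumes "n > 0"
  shows "hecke k n f z = of_nat n powi (k - 1) *
     (\<Sum>p\<in>hecke_index n. of_nat (fst p) powi (- k) * f (mact (hecke_mat n p) z))"
proof -
  have "(\<Sum>d | d dvd n. \<Sum>b<d. of_nat d powi (- k) * f ((of_nat (n div d) * z + of_nat b) / of_nat d)) =
     (\<Sum>p\<in>hecke_index n. of_nat (fst p) powi (- k) * f (mact (hecke_mat n p) z))"
    unfolding hecke_index_def using assms
    by (subst sum.Sigma) (auto simp: moebius_def intro!: sum.cong)
  then show ?thesis by (simp add: hecke_def)
qed

text \<open>Hermite normal form: a Bezout relation for the first column clears the lower left entry,
  and division with remainder reduces the upper right entry modulo the lower right one.\<close>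

lemma exists_hecke_mat:
  assumes det: "mdet M = int n" and n: "n > 0"
  obtains L p where "mdet L = 1" "p \<in> hecke_index n" "M = mmult L (hecke_mat n p)"
proof -
  obtain x y s t where M: "M = (x, y, s, t)" by (metis prod_cases4)
  have d: "x * t - y * s = int n" using det by (simp add: M)
  define g where "g = gcd x s"
  have "x \<noteq> 0 \<or> s \<noteq> 0" using d n by auto
  then have g: "g > 0" by (simp add: g_def)
  obtain u v where uv: "u * x + v * s = g"
    using bezout_int[of x s] by (auto simp: g_def)
  define x' s' where "x' = x div g" and "s' = s div g"
  have xs: "x = g * x'" "s = g * s'" by (simp_all add: x'_def s'_def g_def)
  have ng: "int n = g * (x' * t - s' * y)" using d by (simp add: xs algebra_simps)
  define e where "e = x' * t - s' * y"
  have e: "e > 0" using ng n g by (metis e_def of_nat_0_less_iff zero_less_mult_pos)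
  have "g * (u * x' + v * s') = g * 1" using uv by (simp add: xs algebra_simps)
  then have uv': "u * x' + v * s' = 1" using g by (subst (asm) mult_cancel_left) auto
  define m where "m = (u * y + v * t) div e"
  define b where "b = (u * y + v * t) mod e"
  have bm: "u * y + v * t = b + m * e" by (simp add: b_def m_def)
  \<comment> \<open>The product of the translation by -m with the matrix (u, v; -s', x') that sends
    the first column to (g, 0).\<close>
  define K where "K = (u + m * s', v - m * x', - s', x')"
  have K: "mdet K = 1" using uv' by (simp add: K_def algebra_simps)
  have KM: "mmult K M = (g, b, 0, e)"
    using uv bm by (simp add: K_def M xs e_def algebra_simps)
  define p where "p = (nat e, nat b)"
  have b: "0 \<le> b" "b < e" using e by (simp_all add: b_def)
  have ne: "int n = g * int (nat e)" using ng e by (simp add: e_def)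
  then have n2: "n = nat g * nat e" using g by (metis nat_int nat_mult_distrib order_less_le)
  then have "p \<in> hecke_index n" using b e by (auto simp: p_def hecke_index_def)
  moreover have "n div nat e = nat g" using n2 e by simp
  then have "hecke_mat n p = (g, b, 0, e)" using b e g by (simp add: p_def)
  then have "mmult (madj K) (hecke_mat n p) = M"
    using K by (simp flip: KM add: mmult_madj flip: mmult_assoc)
  ultimately show ?thesis using K that[of "madj K" p] by simp
qed

text \<open>Triangularity of both matrices makes \<open>L\<close> triangular, and determinant 1 with
  a positive corner makes its diagonal 1. Hence d = d', and b, b' are congruent modulo d.\<close>

lemma hecke_mat_unique:
  assumes "p \<in> hecke_index n" "q \<in> hecke_index n" "n > 0" "mdet L = 1" "hecke_mat n p = mmult L (hecke_mat n q)"
  shows "p = q"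
proof -
  obtain d b d' b' where pq: "p = (d, b)" "q = (d', b')" by force
  obtain e1 e2 e3 e4 where L: "L = (e1, e2, e3, e4)" by (metis prod_cases4)
  have dvd: "d dvd n" "d' dvd n" and b: "b < d" "b' < d'"
    using assms(1,2) by (auto simp: pq hecke_index_def)
  have a: "n div d > 0" "n div d' > 0"
    using dvd assms(3) by (simp_all add: div_greater_zero_iff dvd_imp_le dvd_pos_nat)
  have eqs: "int (n div d) = e1 * int (n div d')" "int b = e1 * int b' + e2 * int d'"
    "e3 * int (n div d') = 0" "int d = e3 * int b' + e4 * int d'"
    using assms(5) by (auto simp: pq L)
  have e3: "e3 = 0" using eqs(3) a by simp
  then have "e1 * e4 = 1" using assms(4) by (simp add: L)
  moreover have "e1 > 0" using eqs(1) a by (metis of_nat_0_less_iff zero_less_mult_pos2)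
  ultimately have e: "e1 = 1" "e4 = 1" by (auto simp: zmult_eq_1_iff)
  have dd: "d = d'" using eqs(4) e e3 by simp
  have "int b mod int d = int b' mod int d" using eqs(2) e dd by simp
  then have "b = b'" using b dd by simp
  with dd show ?thesis by (simp add: pq)
qed

text \<open>Right multiplication by \<open>G\<close> permutes the cosets of the representatives,
  through \<open>\<phi>\<close>. The left factors \<open>L p\<close> are absorbed by the modularity
  of f.\<close>

lemma hecke_moebius:
  assumes f: "modular_form k f" and n: "n > 0" and z: "z \<in> upper_half_plane" and G: "mdet G = 1"
  shows "hecke k n f (mact G z) = mfac G z powi k * hecke k n f z"
proof -
  let ?R = "hecke_index n"
  have "\<exists>L q. mdet L = 1 \<and> q \<in> ?R \<and> mmult (hecke_mat n p) G = mmult L (hecke_mat n q)" if "p \<in> ?R" for p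
  proof -
    have "mdet (mmult (hecke_mat n p) G) = int n"
      using mdet_hecke_mat[OF that] G by (simp add: mdet_mmult)
    then show ?thesis by (rule exists_hecke_mat[OF _ n]) blast
  qed
  then obtain L \<phi> where \<phi>: "\<And>p. p \<in> ?R \<Longrightarrow> mdet (L p) = 1" "\<And>p. p \<in> ?R \<Longrightarrow> \<phi> p \<in> ?R"
    "\<And>p. p \<in> ?R \<Longrightarrow> mmult (hecke_mat n p) G = mmult (L p) (hecke_mat n (\<phi> p))"
    by metis
  have "inj_on \<phi> ?R"
  proof (rule inj_onI)
    fix p q assume pq: "p \<in> ?R" "q \<in> ?R" "\<phi> p = \<phi> q"
    have *: "hecke_mat n p = mmult (mmult (L p) (hecke_mat n (\<phi> p))) (madj G)" if "p \<in> ?R" for p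
      using \<phi>(3)[OF that, symmetric] G by (simp add: mmult_assoc mmult_madj)
    have "mmult (madj (L q)) (mmult (L q) N) = N" for N
      using \<phi>(1)[OF pq(2)] by (simp flip: mmult_assoc add: mmult_madj)
    then have "hecke_mat n p = mmult (mmult (L p) (madj (L q))) (hecke_mat n q)"
      using *[OF pq(1)] *[OF pq(2)] pq(3) by (simp add: mmult_assoc)
    moreover have "mdet (mmult (L p) (madj (L q))) = 1"
      using \<phi>(1)[OF pq(1)] \<phi>(1)[OF pq(2)] by (simp add: mdet_mmult)
    ultimately show "p = q" using hecke_mat_unique pq n by blast
  qed
  then have bij: "bij_betw \<phi> ?R ?R"
    using \<phi>(2) finite_hecke_index[OF n] by (simp add: bij_betw_def endo_inj_surj image_subset_iff)
  have summand: "of_nat (fst p) powi (- k) * f (mact (hecke_mat n p) (mact G z)) =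
      mfac G z powi k * (of_nat (fst (\<phi> p)) powi (- k) * f (mact (hecke_mat n (\<phi> p)) z))"
    if p: "p \<in> ?R" for p
  proof -
    define w where "w = mact (hecke_mat n (\<phi> p)) z"
    have dets: "mdet (hecke_mat n p) > 0" "mdet (hecke_mat n (\<phi> p)) > 0"
      using mdet_hecke_mat p \<phi>(2)[OF p] n by auto
    have w: "w \<in> upper_half_plane"
      unfolding w_def by (intro mact_in_upper_half_plane z dets)
    have fac: "mfac (hecke_mat n q) x = of_nat (fst q)" for q x
      by (cases q) simp
    have nz: "of_nat (fst q) \<noteq> (0 :: complex)" if "q \<in> ?R" for q
      using that n by (cases q) (auto simp: hecke_index_def)
    have "mact (hecke_mat n p) (mact G z) = mact (mmult (hecke_mat n p) G) z"
      using G dets by (intro mact_mmult[symmetric] z) auto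
    also have "\<dots> = mact (L p) w"
      unfolding \<phi>(3)[OF p] w_def using \<phi>(1)[OF p] dets by (intro mact_mmult z) auto
    finally have 1: "f (mact (hecke_mat n p) (mact G z)) = mfac (L p) w powi k * f w"
      using modular_form_mact[OF f w \<phi>(1)[OF p]] by simp
    \<comment> \<open>The weight d^(-k) in the Hecke sum is the automorphy factor of the
      representative, whose bottom row is (0, d). Evaluating the cocycle of the same product in two
      ways therefore relates the two summands.\<close>
    have "of_nat (fst p) * mfac G z = mfac (mmult (hecke_mat n p) G) z"
      using G by (simp add: mfac_mmult[OF z] fac)
    also have "\<dots> = mfac (L p) w * of_nat (fst (\<phi> p))"
      unfolding \<phi>(3)[OF p] w_def by (simp add: mfac_mmult[OF z dets(2)] fac)
    finally have "(of_nat (fst p) * mfac G z) powi k = (mfac (L p) w * of_nat (fst (\<phi> p))) powi k"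
      by simp
    then have "of_nat (fst p) powi k * mfac G z powi k = mfac (L p) w powi k * of_nat (fst (\<phi> p)) powi k"
      by (simp add: power_int_mult_distrib)
    then show ?thesis
      unfolding 1 w_def[symmetric] using nz[OF p] nz[OF \<phi>(2)[OF p]]
      by (simp add: power_int_minus field_simps)
  qed
  have "(\<Sum>p\<in>?R. of_nat (fst p) powi (- k) * f (mact (hecke_mat n p) (mact G z))) =
      mfac G z powi k * (\<Sum>p\<in>?R. of_nat (fst (\<phi> p)) powi (- k) * f (mact (hecke_mat n (\<phi> p)) z))"
    by (simp add: summand sum_distrib_left)
  also have "(\<Sum>p\<in>?R. of_nat (fst (\<phi> p)) powi (- k) * f (mact (hecke_mat n (\<phi> p)) z)) =
      (\<Sum>p\<in>?R. of_nat (fst p) powi (- k) * f (mact (hecke_mat n p) z))"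
    by (rule sum.reindex_bij_betw[OF bij])
  finally show ?thesis by (simp add: hecke_eq_sum_mact[OF n])
qed

text \<open>With a = n div d this is the classical formula: the sum over the common divisors a of n
  and r of a^(k-1) times the coefficient of index n r / a^2.\<close>

definition hecke_series :: "nat \<Rightarrow> nat \<Rightarrow> complex fps \<Rightarrow> complex fps" where
  "hecke_series k n F = Abs_fps (\<lambda>r. \<Sum>d | d dvd n. if (n div d) dvd r
     then of_nat (n div d) ^ (k - 1) * fps_nth F (d * (r div (n div d))) else 0)"

lemma sum_roots_of_unity:
  assumes "d > 0"
  shows "(\<Sum>b<d. qexp (of_nat m * of_nat b / of_nat d)) = (if d dvd m then of_nat d else 0)"
proof -
  define w where "w = qexp (of_nat m / of_nat d)"
  have pow: "qexp (of_nat m * of_nat b / of_nat d) = w ^ b" for b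
    unfolding w_def by (simp add: mult.commute flip: qexp_mult_nat)
  have wd: "w ^ d = 1"
    using assms qexp_add_of_int[of 0 "int m"] unfolding w_def qexp_mult_nat[symmetric]
    by (simp add: qexp_def)
  have w1: "w = 1 \<longleftrightarrow> d dvd m"
  proof
    assume "w = 1"
    then obtain n :: int where "2 * pi * (real m / real d) = 2 * of_int n * pi"
      unfolding w_def qexp_def exp_eq_1 by auto
    then have "real m = of_int n * real d"
      using assms by (simp add: field_simps)
    then have "int m = n * int d" by (metis of_int_eq_iff of_int_mult of_int_of_nat_eq)
    then have "int d dvd int m" by simp
    then show "d dvd m" by simp
  next
    assume "d dvd m"
    then obtain c where "m = d * c" ..
    then have "w = qexp (0 + of_int (int c))" using assms by (simp add: w_def)
    then show "w = 1" unfolding qexp_add_of_int by (simp add: qexp_def)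
  qed
  show ?thesis
    using sum_gp_strict[of w d] wd w1 by (simp add: pow)
qed

lemma has_sum_of_sum:
  fixes f :: "'a \<Rightarrow> 'b \<Rightarrow> 'c :: topological_comm_monoid_add"
  assumes "finite A" "\<And>x. x \<in> A \<Longrightarrow> (f x has_sum s x) S"
  shows "((\<lambda>y. \<Sum>x\<in>A. f x y) has_sum (\<Sum>x\<in>A. s x)) S"
  using assms by (induction A rule: finite_induct) (auto intro: has_sum_add)

lemma has_q_expansion_has_sum:
  assumes "has_q_expansion f F" "z \<in> upper_half_plane"
  shows "((\<lambda>m. fps_nth F m * qexp z ^ m) has_sum f z) UNIV"
proof -
  have r: "fps_conv_radius F \<ge> 1" using assms by (simp add: has_q_expansion_iff)
  have "summable (\<lambda>m. norm (fps_nth F m * qexp z ^ m))"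
    by (rule norm_summable_fps[OF norm_qexp_less_conv_radius[OF r assms(2)]])
  then show ?thesis
    using assms by (intro norm_summable_imp_has_sum) (auto simp: has_q_expansion_def qexp_def)
qed

text \<open>Averaging over the translations b kills, by orthogonality of roots of unity, every
  coefficient whose index is not divisible by d.\<close>

lemma hecke_inner_sum:
  assumes f: "has_q_expansion f F" and z: "z \<in> upper_half_plane" and d: "d > 0" and a: "a > 0"
  shows "((\<lambda>r. if a dvd r then of_nat d * (fps_nth F (d * (r div a)) * qexp z ^ r) else 0) has_sum
     (\<Sum>b<d. f ((of_nat a * z + of_nat b) / of_nat d))) UNIV"
proof -
  let ?w = "of_nat a * z / of_nat d"
  have w: "(of_nat a * z + of_nat b) / of_nat d \<in> upper_half_plane" for b
    using z d a by (simp add: upper_half_plane_def)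
  have "((\<lambda>m. \<Sum>b<d. fps_nth F m * qexp ((of_nat a * z + of_nat b) / of_nat d) ^ m) has_sum
     (\<Sum>b<d. f ((of_nat a * z + of_nat b) / of_nat d))) UNIV"
    by (intro has_sum_of_sum finite_lessThan has_q_expansion_has_sum[OF f w])
  also have "(\<lambda>m. \<Sum>b<d. fps_nth F m * qexp ((of_nat a * z + of_nat b) / of_nat d) ^ m) =
      (\<lambda>m. if d dvd m then of_nat d * (fps_nth F m * qexp ?w ^ m) else 0)"
  proof
    fix m
    have "qexp ((of_nat a * z + of_nat b) / of_nat d) ^ m = qexp ?w ^ m * qexp (of_nat m * of_nat b / of_nat d)" for b
      by (simp add: qexp_def algebra_simps add_divide_distrib flip: exp_of_nat_mult exp_add)
    then have "(\<Sum>b<d. fps_nth F m * qexp ((of_nat a * z + of_nat b) / of_nat d) ^ m) =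
        fps_nth F m * qexp ?w ^ m * (\<Sum>b<d. qexp (of_nat m * of_nat b / of_nat d))"
      by (simp add: sum_distrib_left mult_ac)
    then show "(\<Sum>b<d. fps_nth F m * qexp ((of_nat a * z + of_nat b) / of_nat d) ^ m) =
        (if d dvd m then of_nat d * (fps_nth F m * qexp ?w ^ m) else 0)"
      by (simp add: sum_roots_of_unity[OF d])
  qed
  finally have "((\<lambda>m. of_nat d * (fps_nth F m * qexp ?w ^ m)) has_sum
     (\<Sum>b<d. f ((of_nat a * z + of_nat b) / of_nat d))) {m. d dvd m}"
    by (rule has_sum_cong_neutral[THEN iffD1, rotated -1]) auto
  also have "?this \<longleftrightarrow> ((\<lambda>r. of_nat d * (fps_nth F (d * (r div a)) * qexp z ^ r)) has_sum
     (\<Sum>b<d. f ((of_nat a * z + of_nat b) / of_nat d))) {r. a dvd r}"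
  \<comment> \<open>The substitution m = d c, r = a c turns the m-th power of q at a z / d into
    q^r.\<close>
  proof (rule has_sum_reindex_bij_witness[of _ "\<lambda>r. d * (r div a)" "\<lambda>m. a * (m div d)"])
    fix m assume "m \<in> {m. d dvd m}"
    then obtain c where m: "m = d * c" by auto
    have "qexp ?w ^ m = qexp z ^ (a * c)"
      using d by (simp add: m mult.commute flip: qexp_mult_nat)
    then show "of_nat d * (fps_nth F (d * (a * (m div d) div a)) * qexp z ^ (a * (m div d))) =
        of_nat d * (fps_nth F m * qexp ?w ^ m)"
      using d a by (simp add: m)
  qed (use a d in auto)
  finally show ?thesis
    by (rule has_sum_cong_neutral[THEN iffD1, rotated -1]) auto
qed

lemma has_q_expansion_hecke:
  assumes f: "has_q_expansion f F" and n: "n > 0" and k: "k > 0"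
  shows "has_q_expansion (hecke (int k) n f) (hecke_series k n F)"
  unfolding has_q_expansion_def
proof
  fix z assume z: "z \<in> upper_half_plane"
  have "((\<lambda>r. \<Sum>d | d dvd n. of_nat n powi (int k - 1) * of_nat d powi (- int k) *
        (if (n div d) dvd r then of_nat d * (fps_nth F (d * (r div (n div d))) * qexp z ^ r) else 0)) has_sum
      (\<Sum>d | d dvd n. of_nat n powi (int k - 1) * of_nat d powi (- int k) *
        (\<Sum>b<d. f ((of_nat (n div d) * z + of_nat b) / of_nat d)))) UNIV"
    using n by (intro has_sum_of_sum has_sum_cmult_right hecke_inner_sum[OF f z])
       (simp_all add: div_greater_zero_iff dvd_imp_le dvd_pos_nat)
  also have "(\<Sum>d | d dvd n. of_nat n powi (int k - 1) * of_nat d powi (- int k) *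
        (\<Sum>b<d. f ((of_nat (n div d) * z + of_nat b) / of_nat d))) = hecke (int k) n f z"
    by (simp add: hecke_def sum_distrib_left mult_ac)
  also have "(\<lambda>r. \<Sum>d | d dvd n. of_nat n powi (int k - 1) * of_nat d powi (- int k) *
        (if (n div d) dvd r then of_nat d * (fps_nth F (d * (r div (n div d))) * qexp z ^ r) else 0)) =
      (\<lambda>r. fps_nth (hecke_series k n F) r * qexp z ^ r)"
  proof
    fix r
    have "of_nat n powi (int k - 1) * of_nat d powi (- int k) * of_nat d = (of_nat (n div d) ^ (k - 1) :: complex)"
      if "d dvd n" for d
    proof -
      have d: "of_nat d \<noteq> (0 :: complex)" using that n by auto
      have "of_nat n powi (int k - 1) = (of_nat n ^ (k - 1) :: complex)"
        using k by (simp add: power_int_def nat_diff_distrib)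
      moreover have "of_nat d powi (- int k) = 1 / (of_nat d ^ Suc (k - 1) :: complex)"
        using k by (simp add: power_int_minus inverse_eq_divide del: power_Suc)
      ultimately show ?thesis
        using d that by (auto simp: power_mult_distrib)
    qed
    then show "(\<Sum>d | d dvd n. of_nat n powi (int k - 1) * of_nat d powi (- int k) *
        (if (n div d) dvd r then of_nat d * (fps_nth F (d * (r div (n div d))) * qexp z ^ r) else 0)) =
      fps_nth (hecke_series k n F) r * qexp z ^ r"
      unfolding hecke_series_def fps_nth_Abs_fps sum_distrib_right
      by (intro sum.cong refl) (simp flip: mult.assoc)
  qed
  finally show "(\<lambda>r. fps_nth (hecke_series k n F) r * exp (2 * of_real pi * \<i> * z) ^ r) sums hecke (int k) n f z"
    unfolding qexp_def by (rule has_sum_imp_sums)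
qed

lemma modular_form_hecke:
  assumes f: "modular_form (int k) f" and n: "n > 0" and k: "k > 0"
  shows "modular_form (int k) (hecke (int k) n f)"
proof -
  obtain F where "has_q_expansion f F" using f by (auto simp: modular_form_def)
  from has_q_expansion_hecke[OF this n k]
  have q: "has_q_expansion (hecke (int k) n f) (hecke_series k n F)" .
  have "hecke (int k) n f ((of_int a * z + of_int b) / (of_int c * z + of_int d)) =
      (of_int c * z + of_int d) powi int k * hecke (int k) n f z"
    if "a * d - b * c = 1" "z \<in> upper_half_plane" for a b c d z
    using hecke_moebius[OF f n that(2), of "(a, b, c, d)"] that(1) by (simp add: moebius_def)
  with q show ?thesis
    unfolding modular_form_def using has_q_expansion_holomorphic[OF q] by blast
qed

lemma mf_series_hecke:
  assumes "mf_series k F" "n > 0" "k > 0"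
  shows "mf_series k (hecke_series k n F)"
  using assms modular_form_hecke has_q_expansion_hecke unfolding mf_series_def by blast

lemma hecke_series_nth_0:
  assumes "fps_nth F 0 = 0"
  shows "fps_nth (hecke_series k n F) 0 = 0"
  using assms by (simp add: hecke_series_def)

text \<open>Only d = n contributes at r = 1. For a form with coefficient 1 at q, this identifies
  Hecke eigenvalues with coefficients.\<close>

lemma hecke_series_nth_1:
  assumes "n > 0"
  shows "fps_nth (hecke_series k n F) 1 = fps_nth F n"
proof -
  have "fps_nth (hecke_series k n F) 1 = (\<Sum>d\<in>{n}. if (n div d) dvd 1
     then of_nat (n div d) ^ (k - 1) * fps_nth F (d * (1 div (n div d))) else 0)"
    unfolding hecke_series_def fps_nth_Abs_fps
    by (rule sum.mono_neutral_right) (use assms in auto)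
  then show ?thesis using assms by simp
qed

lemma dvd_2_iff: "a dvd (2::nat) \<longleftrightarrow> a = 1 \<or> a = 2"
  by (metis One_nat_def dvd_refl one_dvd prime_nat_iff two_is_prime_nat)

text \<open>The right-hand side is the same as in \<open>hecke_series_2_nth\<close>; this symmetry
  between 2 and n transfers information from T_2 to T_n. Only n div d = 1 and n div d = 2 can divide
  2.\<close>

lemma hecke_series_nth_2:
  assumes n: "n > 0"
  shows "fps_nth (hecke_series k n F) 2 = fps_nth F (2 * n) + (if even n then 2 ^ (k - 1) * fps_nth F (n div 2) else 0)"
proof (cases "even n")
  case True
  then obtain m where m: "n = 2 * m" by auto
  with n have m0: "m > 0" by simp
  have "fps_nth (hecke_series k n F) 2 = (\<Sum>d\<in>{n, m}. if (n div d) dvd 2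
     then of_nat (n div d) ^ (k - 1) * fps_nth F (d * (2 div (n div d))) else 0)"
    unfolding hecke_series_def fps_nth_Abs_fps
  proof (rule sum.mono_neutral_right)
    show "\<forall>d\<in>{d. d dvd n} - {n, m}. (if (n div d) dvd 2
     then of_nat (n div d) ^ (k - 1) * fps_nth F (d * (2 div (n div d))) else 0) = 0"
    proof
      fix d assume d: "d \<in> {d. d dvd n} - {n, m}"
      then obtain c where c: "n = d * c" by auto
      with n have "d > 0" by auto
      then have "n div d = c" "c \<noteq> 1" "c \<noteq> 2" using d m c by auto
      then show "(if (n div d) dvd 2
        then of_nat (n div d) ^ (k - 1) * fps_nth F (d * (2 div (n div d))) else 0) = 0"
        by (simp add: dvd_2_iff)
    qed
  qed (use n m in auto)
  then show ?thesis using True m m0 by (simp add: mult_ac)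
next
  case False
  have "fps_nth (hecke_series k n F) 2 = (\<Sum>d\<in>{n}. if (n div d) dvd 2
     then of_nat (n div d) ^ (k - 1) * fps_nth F (d * (2 div (n div d))) else 0)"
    unfolding hecke_series_def fps_nth_Abs_fps
  proof (rule sum.mono_neutral_right)
    show "\<forall>d\<in>{d. d dvd n} - {n}. (if (n div d) dvd 2
     then of_nat (n div d) ^ (k - 1) * fps_nth F (d * (2 div (n div d))) else 0) = 0"
    proof
      fix d assume d: "d \<in> {d. d dvd n} - {n}"
      then obtain c where c: "n = d * c" by auto
      with n have "d > 0" by auto
      then have "n div d = c" "c \<noteq> 1" "c \<noteq> 2" using d c False by auto
      then show "(if (n div d) dvd 2
        then of_nat (n div d) ^ (k - 1) * fps_nth F (d * (2 div (n div d))) else 0) = 0"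
        by (simp add: dvd_2_iff)
    qed
  qed (use n in auto)
  then show ?thesis using False n by (simp add: mult_ac)
qed

lemma hecke_series_2_nth:
  "fps_nth (hecke_series k 2 F) n = fps_nth F (2 * n) + (if even n then 2 ^ (k - 1) * fps_nth F (n div 2) else 0)"
proof -
  have "{d. d dvd (2::nat)} = {1, 2}" by (auto simp: dvd_2_iff)
  then show ?thesis by (simp add: hecke_series_def)
qed

text \<open>Translates the analytic definition into conditions on the series alone; the unknown
  eigenvalues become the coefficients.\<close>

lemma primitive_forms_iff:
  assumes k: "k > 0"
  shows "F \<in> primitive_forms (int k) \<longleftrightarrow> mf_series k F \<and> fps_nth F 0 = 0 \<and> fps_nth F 1 = 1 \<and>
    (\<forall>n>0. hecke_series k n F = fps_const (fps_nth F n) * F)"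
proof
  assume "F \<in> primitive_forms (int k)"
  then obtain f where f: "cusp_form (int k) f" "hecke_eigenform (int k) f" "has_q_expansion f F" "fps_nth F 1 = 1"
    by (auto simp: primitive_forms_def)
  have F0: "fps_nth F 0 = 0"
    using f(1,3) has_q_expansion_unique unfolding cusp_form_def by blast
  have "hecke_series k n F = fps_const (fps_nth F n) * F" if n: "n > 0" for n
  proof -
    obtain ev where ev: "\<And>z. z \<in> upper_half_plane \<Longrightarrow> hecke (int k) n f z = ev * f z"
      using f(2) n unfolding hecke_eigenform_def by blast
    have "has_q_expansion (hecke (int k) n f) (fps_const ev * F)"
      using has_q_expansion_cmult[OF f(3), of ev] ev unfolding has_q_expansion_def by simp
    then have eq: "hecke_series k n F = fps_const ev * F"
      using has_q_expansion_hecke[OF f(3) n k] by (rule has_q_expansion_unique[symmetric])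
    \<comment> \<open>The normalisation at q lets the eigenvalue be read off.\<close>
    then have "fps_nth (hecke_series k n F) 1 = ev" using f(4) by simp
    then show ?thesis using eq hecke_series_nth_1[OF n] by metis
  qed
  then show "mf_series k F \<and> fps_nth F 0 = 0 \<and> fps_nth F 1 = 1 \<and>
    (\<forall>n>0. hecke_series k n F = fps_const (fps_nth F n) * F)"
    using f F0 by (auto simp: cusp_form_def mf_series_def)
next
  assume *: "mf_series k F \<and> fps_nth F 0 = 0 \<and> fps_nth F 1 = 1 \<and>
    (\<forall>n>0. hecke_series k n F = fps_const (fps_nth F n) * F)"
  then obtain f where f: "modular_form (int k) f" "has_q_expansion f F"
    by (auto simp: mf_series_def)
  have "hecke_eigenform (int k) f"
    unfolding hecke_eigenform_def
  proof (intro allI impI exI ballI)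
    fix n :: nat and z assume n: "n > 0" and z: "z \<in> upper_half_plane"
    have "has_q_expansion (hecke (int k) n f) (fps_const (fps_nth F n) * F)"
      using has_q_expansion_hecke[OF f(2) n k] * n by simp
    with has_q_expansion_cmult[OF f(2), of "fps_nth F n"] z
    show "hecke (int k) n f z = fps_nth F n * f z"
      unfolding has_q_expansion_def using sums_unique2 by blast
  qed
  with f * show "F \<in> primitive_forms (int k)"
    by (auto simp: primitive_forms_def cusp_form_def)
qed

text \<open>Plays the role of the bound m on the dimension of the space of weight k: forms are
  determined by their first m coefficients.\<close>

definition vanish_order :: "nat \<Rightarrow> nat \<Rightarrow> bool" where
  "vanish_order k m \<longleftrightarrow> (\<forall>F. mf_series k F \<longrightarrow> (\<forall>n<m. fps_nth F n = 0) \<longrightarrow> F = 0)"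

lemma vanish_orderD:
  assumes "vanish_order k m" "mf_series k F" "mf_series k G" "\<And>n. n < m \<Longrightarrow> fps_nth F n = fps_nth G n"
  shows "F = G"
  using assms mf_series_diff[OF assms(2,3)] unfolding vanish_order_def
  by (metis eq_iff_diff_eq_0 fps_sub_nth)

text \<open>T_n G and a_n G both lack a constant term and both have coefficient a_n at q, so they
  coincide.\<close>

lemma primitive_forms_dim_1:
  assumes k: "k > 0" and v: "vanish_order k 2" and G: "mf_series k G" "fps_nth G 0 = 0" "fps_nth G 1 = 1"
  shows "primitive_forms (int k) = {G}"
proof -
  have "F = G" if "F \<in> primitive_forms (int k)" for F
  proof (rule vanish_orderD[OF v _ G(1)])
    show "mf_series k F" using that by (simp add: primitive_forms_iff[OF k])
    show "fps_nth F n = fps_nth G n" if "n < 2" for n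
      using that \<open>F \<in> primitive_forms (int k)\<close> G by (auto simp: primitive_forms_iff[OF k] less_2_cases_iff)
  qed
  moreover have "hecke_series k n G = fps_const (fps_nth G n) * G" if n: "n > 0" for n
  proof (rule vanish_orderD[OF v mf_series_hecke[OF G(1) n k] mf_series_cmult[OF G(1)]])
    show "fps_nth (hecke_series k n G) m = fps_nth (fps_const (fps_nth G n) * G) m" if "m < 2" for m
      using that G hecke_series_nth_0[OF G(2), of k n] hecke_series_nth_1[OF n, of k G]
      by (auto simp: less_2_cases_iff)
  qed
  ultimately show ?thesis using G by (auto simp: primitive_forms_iff[OF k])
qed

text \<open>In the two-dimensional case the eigenvalue equation for the second Hecke operator alone,
  read off at the second coefficient, already forces all others.\<close>

lemma primitive_forms_dim_2:
  assumes k: "k > 0" and v: "vanish_order k 3" and F: "mf_series k F" "fps_nth F 0 = 0" "fps_nth F 1 = 1"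
  shows "F \<in> primitive_forms (int k) \<longleftrightarrow> fps_nth F 4 + 2 ^ (k - 1) = (fps_nth F 2)\<^sup>2"
proof
  assume "F \<in> primitive_forms (int k)"
  then have "hecke_series k 2 F = fps_const (fps_nth F 2) * F"
    by (simp add: primitive_forms_iff[OF k])
  then have "fps_nth (hecke_series k 2 F) 2 = fps_nth (fps_const (fps_nth F 2) * F) 2" by simp
  then show "fps_nth F 4 + 2 ^ (k - 1) = (fps_nth F 2)\<^sup>2"
    using F by (simp add: hecke_series_2_nth power2_eq_square)
next
  assume *: "fps_nth F 4 + 2 ^ (k - 1) = (fps_nth F 2)\<^sup>2"
  have less_3: "m < 3 \<longleftrightarrow> m = 0 \<or> m = 1 \<or> m = 2" for m :: nat by auto
  have T2: "hecke_series k 2 F = fps_const (fps_nth F 2) * F"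
  proof (rule vanish_orderD[OF v mf_series_hecke[OF F(1) _ k] mf_series_cmult[OF F(1)]])
    show "fps_nth (hecke_series k 2 F) m = fps_nth (fps_const (fps_nth F 2) * F) m" if "m < 3" for m
      using that * F unfolding less_3 by (auto simp: hecke_series_2_nth power2_eq_square)
  qed simp
  have "hecke_series k n F = fps_const (fps_nth F n) * F" if n: "n > 0" for n
  proof (rule vanish_orderD[OF v mf_series_hecke[OF F(1) n k] mf_series_cmult[OF F(1)]])
    \<comment> \<open>The symmetry between 2 and n, followed by the eigenvalue equation for T_2,
      gives the one coefficient of T_n F that is not yet known.\<close>
    have "fps_nth (hecke_series k n F) 2 = fps_nth (hecke_series k 2 F) n"
      by (simp add: hecke_series_2_nth hecke_series_nth_2[OF n])
    also have "\<dots> = fps_nth F n * fps_nth F 2"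
      by (simp add: T2)
    finally show "fps_nth (hecke_series k n F) m = fps_nth (fps_const (fps_nth F n) * F) m" if "m < 3" for m
      using that F hecke_series_nth_0[OF F(2), of k n] hecke_series_nth_1[OF n, of k F]
      unfolding less_3 by auto
  qed
  then show "F \<in> primitive_forms (int k)"
    using F by (simp add: primitive_forms_iff[OF k])
qed

section \<open>Forms of small weight\<close>

lemma fps_mult_nth_small:
  "fps_nth (F * G) 0 = fps_nth F 0 * fps_nth G 0"
  "fps_nth (F * G) 1 = fps_nth F 0 * fps_nth G 1 + fps_nth F 1 * fps_nth G 0"
  "fps_nth (F * G) 2 = fps_nth F 0 * fps_nth G 2 + fps_nth F 1 * fps_nth G 1 + fps_nth F 2 * fps_nth G 0"
  "fps_nth (F * G) 3 = fps_nth F 0 * fps_nth G 3 + fps_nth F 1 * fps_nth G 2 + fps_nth F 2 * fps_nth G 1 +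
     fps_nth F 3 * fps_nth G 0"
  "fps_nth (F * G) 4 = fps_nth F 0 * fps_nth G 4 + fps_nth F 1 * fps_nth G 3 + fps_nth F 2 * fps_nth G 2 +
     fps_nth F 3 * fps_nth G 1 + fps_nth F 4 * fps_nth G 0"
  by (simp_all add: fps_mult_nth eval_nat_numeral sum.atLeast0_atMost_Suc)

lemma sigma_series_nth:
  "fps_nth (sigma_series j) 0 = 0"
  "fps_nth (sigma_series j) (Suc 0) = 1"
  "fps_nth (sigma_series j) 2 = 1 + 2 ^ j"
  "fps_nth (sigma_series j) 3 = 1 + 3 ^ j"
  "fps_nth (sigma_series j) 4 = 1 + 2 ^ j + 4 ^ j"
proof -
  have "{d. d dvd (2::nat)} = {1, 2}" by (auto simp: dvd_2_iff)
  moreover have "{d. d dvd (3::nat)} = {1, 3}"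
  proof -
    have "d = 1 \<or> d = 3" if "d dvd 3" for d :: nat
    proof -
      have "d = 0 \<or> d = 1 \<or> d = 2 \<or> d = 3" using dvd_imp_le[OF that] by linarith
      with that show ?thesis by (elim disjE) simp_all
    qed
    then show ?thesis by auto
  qed
  moreover have "{d. d dvd (4::nat)} = {1, 2, 4}"
  proof -
    have "d = 1 \<or> d = 2 \<or> d = 4" if "d dvd 4" for d :: nat
    proof -
      have "d = 0 \<or> d = 1 \<or> d = 2 \<or> d = 3 \<or> d = 4" using dvd_imp_le[OF that] by linarith
      with that show ?thesis by (elim disjE) simp_all
    qed
    then show ?thesis by auto
  qed
  ultimately show "fps_nth (sigma_series j) 0 = 0"
    "fps_nth (sigma_series j) (Suc 0) = 1"
    "fps_nth (sigma_series j) 2 = 1 + 2 ^ j"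
    "fps_nth (sigma_series j) 3 = 1 + 3 ^ j"
    "fps_nth (sigma_series j) 4 = 1 + 2 ^ j + 4 ^ j"
    by (simp_all add: sigma_series_def)
qed

lemma vanish_order_bound: "real k < 10.87 * real m \<Longrightarrow> vanish_order k m"
  unfolding vanish_order_def using mf_series_vanish_bound' by blast

text \<open>With a = 0 the series would have no constant term and hence vanish, although its
  coefficient at q is 1.\<close>

lemma eisenstein_const_neq_0:
  assumes "mf_series k (fps_const a + sigma_series (k - 1))" "vanish_order k 1"
  shows "a \<noteq> 0"
proof
  assume "a = 0"
  with assms have "sigma_series (k - 1) = 0"
    unfolding vanish_order_def by (force simp: sigma_series_nth)
  then have "fps_nth (sigma_series (k - 1)) 1 = fps_nth 0 1" by simp
  then show False by (simp add: sigma_series_nth)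
qed

text \<open>Cross-multiplication gives both sides the same constant term, and in weight k + l this
  term determines the form.\<close>

lemma eisenstein_const_proportional:
  assumes v: "vanish_order (k + l) 1" and F: "mf_series k F"
    and G: "mf_series l G" and H: "mf_series (k + l) H"
  shows "fps_const (fps_nth H 0) * (F * G) = fps_const (fps_nth F 0 * fps_nth G 0) * H"
  by (rule vanish_orderD[OF v mf_series_cmult[OF mf_series_mult[OF F G]] mf_series_cmult[OF H]])
     (simp add: fps_mult_nth_small)

text \<open>The constant terms of the Eisenstein series are forced by the proportionality of
  \<open>E\<^sub>4\<^sup>2\<close> and \<open>E\<^sub>8\<close> and of \<open>E\<^sub>4 E\<^sub>6\<close> and \<open>E\<^sub>1\<^sub>0\<close>, so no zeta value is needed.\<close>

lemma mf_series_eisenstein_4_8: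
  "mf_series 4 (fps_const (1 / 240) + sigma_series 3)"
  "mf_series 8 (fps_const (1 / 480) + sigma_series 7)"
proof -
  obtain a b where a: "mf_series 4 (fps_const a + sigma_series 3)"
    and b: "mf_series 8 (fps_const b + sigma_series 7)"
    using mf_series_eisenstein[of 4] mf_series_eisenstein[of 8] by auto
  have v: "vanish_order 4 1" "vanish_order 8 1" by (rule vanish_order_bound; simp)+
  have ab: "a \<noteq> 0" "b \<noteq> 0"
    using eisenstein_const_neq_0[of 4 a] eisenstein_const_neq_0[of 8 b] a b v by simp_all
  let ?A = "fps_const a + sigma_series 3" and ?B = "fps_const b + sigma_series 7"
  have eq: "fps_const (fps_nth ?B 0) * (?A * ?A) = fps_const (fps_nth ?A 0 * fps_nth ?A 0) * ?B"
    using eisenstein_const_proportional[of 4 4 ?A ?A ?B] v a b by simp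
  have "fps_nth (fps_const (fps_nth ?B 0) * (?A * ?A)) 1 = fps_nth (fps_const (fps_nth ?A 0 * fps_nth ?A 0) * ?B) 1"
    by (simp only: eq)
  then have "b * (2 * a) = a * a"
    by (simp add: fps_mult_nth_small sigma_series_nth)
  with ab have a2: "a = 2 * b" by (simp add: mult.commute)
  have "fps_nth (fps_const (fps_nth ?B 0) * (?A * ?A)) 2 = fps_nth (fps_const (fps_nth ?A 0 * fps_nth ?A 0) * ?B) 2"
    by (simp only: eq)
  \<comment> \<open>Here 18 is twice sigma_3(2) = 9, and 129 is sigma_7(2).\<close>
  then have "b * (18 * a + 1) = a * a * 129"
    by (simp add: fps_mult_nth_small sigma_series_nth)
  then have "b * (480 * b) = b * 1" unfolding a2 by (simp add: algebra_simps)
  with ab have "b = 1 / 480" by (subst (asm) mult_cancel_left) (simp add: field_simps)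
  with a b a2 show "mf_series 4 (fps_const (1 / 240) + sigma_series 3)"
    "mf_series 8 (fps_const (1 / 480) + sigma_series 7)" by simp_all
qed

lemma mf_series_eisenstein_6_10:
  "mf_series 6 (fps_const (- 1 / 504) + sigma_series 5)"
  "mf_series 10 (fps_const (- 1 / 264) + sigma_series 9)"
proof -
  obtain a b where a: "mf_series 6 (fps_const a + sigma_series 5)"
    and b: "mf_series 10 (fps_const b + sigma_series 9)"
    using mf_series_eisenstein[of 6] mf_series_eisenstein[of 10] by auto
  have v: "vanish_order 6 1" "vanish_order 10 1" by (rule vanish_order_bound; simp)+
  have ab: "a \<noteq> 0" "b \<noteq> 0"
    using eisenstein_const_neq_0[of 6 a] eisenstein_const_neq_0[of 10 b] a b v by simp_all
  let ?C = "fps_const (1 / 240) + sigma_series 3"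
  let ?A = "fps_const a + sigma_series 5" and ?B = "fps_const b + sigma_series 9"
  have eq: "fps_const (fps_nth ?B 0) * (?C * ?A) = fps_const (fps_nth ?C 0 * fps_nth ?A 0) * ?B"
    using eisenstein_const_proportional[of 4 6 ?C ?A ?B] v a b mf_series_eisenstein_4_8(1) by simp
  have "fps_nth (fps_const (fps_nth ?B 0) * (?C * ?A)) 1 = fps_nth (fps_const (fps_nth ?C 0 * fps_nth ?A 0) * ?B) 1"
    by (simp only: eq)
  then have 1: "b * (1 / 240 + a) = a / 240"
    by (simp add: fps_mult_nth_small sigma_series_nth)
  have "fps_nth (fps_const (fps_nth ?B 0) * (?C * ?A)) 2 = fps_nth (fps_const (fps_nth ?C 0 * fps_nth ?A 0) * ?B) 2"
    by (simp only: eq)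
  \<comment> \<open>The numbers are sigma_5(2) = 33, sigma_3(2) = 9 and sigma_9(2) = 513. Replacing
    a / 240 by relation \<open>1\<close> leaves a common factor \<open>b\<close> and a linear
    equation for \<open>a\<close>.\<close>
  then have "b * (33 / 240 + 1 + 9 * a) = a / 240 * 513"
    by (simp add: fps_mult_nth_small sigma_series_nth add_ac)
  also have "a / 240 * 513 = b * (513 * (1 / 240 + a))"
    unfolding 1[symmetric] by simp
  finally have eq': "33 / 240 + 1 + 9 * a = 513 * (1 / 240 + a)" using ab by simp
  have "504 * a = 513 * (1 / 240 + a) - 9 * a - 513 / 240" by simp
  also have "\<dots> = - 1" unfolding eq'[symmetric] by simp
  finally have "504 * a = - 1" .
  then have a': "a = - 1 / 504" by (simp add: field_simps)
  with 1 have "b = - 1 / 264" by (simp add: field_simps)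
  with a b a' show "mf_series 6 (fps_const (- 1 / 504) + sigma_series 5)"
    "mf_series 10 (fps_const (- 1 / 264) + sigma_series 9)" by simp_all
qed

section \<open>Bernoulli numbers and the normalised Eisenstein series\<close>

lemma bernoulli_fact_rec:
  "bernoulli n / fact n = (if n = 0 then 1 else 0) - (\<Sum>i<n. bernoulli i / fact i / fact (Suc n - i))"
proof -
  define B where "B = fps_X / (fps_exp 1 - 1 :: real fps)"
  define E where "E = Abs_fps (\<lambda>n. 1 / fact (Suc n) :: real)"
  have B: "fps_nth B m = bernoulli m / fact m" for m
    by (simp add: B_def bernoulli_def)
  have XE: "fps_exp 1 - 1 = fps_X * E"
  proof (rule fps_ext)
    show "fps_nth (fps_exp 1 - 1 :: real fps) m = fps_nth (fps_X * E) m" for m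
      by (cases m) (auto simp: E_def algebra_simps)
  qed
  have E0: "fps_nth E 0 \<noteq> 0" by (simp add: E_def)
  have "B = inverse E"
    unfolding B_def XE using E0 by (simp add: fps_divide_times_eq fps_divide_unit)
  \<comment> \<open>The recursion is this identity at the n-th coefficient with the summand i = n
    split off; \<open>E\<close> is the exponential series minus 1, divided by the variable.\<close>
  then have "B * E = 1" using E0 by (simp add: inverse_mult_eq_1)
  then have "fps_nth (B * E) n = fps_nth 1 n" by simp
  moreover have "fps_nth (B * E) n = (\<Sum>i<n. fps_nth B i * fps_nth E (n - i)) + fps_nth B n"
    by (simp add: fps_mult_nth atLeast0AtMost lessThan_Suc_atMost[symmetric] E_def)
  moreover have "(\<Sum>i<n. fps_nth B i * fps_nth E (n - i)) = (\<Sum>i<n. bernoulli i / fact i / fact (Suc n - i))"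
    by (intro sum.cong) (auto simp: B E_def Suc_diff_le)
  ultimately show ?thesis by (simp add: B split: if_splits)
qed

lemma bernoulli_values:
  "bernoulli 4 = - 1 / 30" "bernoulli 6 = 1 / 42" "bernoulli 8 = - 1 / 30"
  "bernoulli 10 = 5 / 66" "bernoulli 14 = 7 / 6"
proof -
  define b where "b n = bernoulli n / fact n" for n
  note rec = bernoulli_fact_rec[folded b_def]
  have b0: "b 0 = 1" by (subst rec) simp
  have b1: "b (Suc 0) = - 1 / 2" by (subst rec) (simp add: b0)
  have b2: "b 2 = 1 / 12" by (subst rec) (simp add: b0 b1 lessThan_nat_numeral lessThan_Suc fact_numeral)
  have b3: "b 3 = 0" by (subst rec) (simp add: b0 b1 b2 lessThan_nat_numeral lessThan_Suc fact_numeral)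
  have b4: "b 4 = - 1 / 720"
    by (subst rec) (simp add: b0 b1 b2 b3 lessThan_nat_numeral lessThan_Suc fact_numeral)
  have b5: "b 5 = 0"
    by (subst rec) (simp add: b0 b1 b2 b3 b4 lessThan_nat_numeral lessThan_Suc fact_numeral)
  have b6: "b 6 = 1 / 30240"
    by (subst rec) (simp add: b0 b1 b2 b3 b4 b5 lessThan_nat_numeral lessThan_Suc fact_numeral)
  have b7: "b 7 = 0"
    by (subst rec) (simp add: b0 b1 b2 b3 b4 b5 b6 lessThan_nat_numeral lessThan_Suc fact_numeral)
  have b8: "b 8 = - 1 / 1209600"
    by (subst rec) (simp add: b0 b1 b2 b3 b4 b5 b6 b7 lessThan_nat_numeral lessThan_Suc fact_numeral)
  have b9: "b 9 = 0"
    by (subst rec) (simp add: b0 b1 b2 b3 b4 b5 b6 b7 b8 lessThan_nat_numeral lessThan_Suc fact_numeral)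
  have b10: "b 10 = 1 / 47900160"
    by (subst rec) (simp add: b0 b1 b2 b3 b4 b5 b6 b7 b8 b9 lessThan_nat_numeral lessThan_Suc fact_numeral)
  have b11: "b 11 = 0"
    by (subst rec) (simp add: b0 b1 b2 b3 b4 b5 b6 b7 b8 b9 b10 lessThan_nat_numeral lessThan_Suc fact_numeral)
  have b12: "b 12 = - 691 / 1307674368000"
    by (subst rec) (simp add: b0 b1 b2 b3 b4 b5 b6 b7 b8 b9 b10 b11 lessThan_nat_numeral lessThan_Suc fact_numeral)
  have b13: "b 13 = 0"
    by (subst rec) (simp add: b0 b1 b2 b3 b4 b5 b6 b7 b8 b9 b10 b11 b12 lessThan_nat_numeral lessThan_Suc fact_numeral)
  have b14: "b 14 = 1 / 74724249600"
    by (subst rec) (simp add: b0 b1 b2 b3 b4 b5 b6 b7 b8 b9 b10 b11 b12 b13 lessThan_nat_numeral lessThan_Suc fact_numeral)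
  have "bernoulli n = b n * fact n" for n by (simp add: b_def)
  then show "bernoulli 4 = - 1 / 30" "bernoulli 6 = 1 / 42" "bernoulli 8 = - 1 / 30"
    "bernoulli 10 = 5 / 66" "bernoulli 14 = 7 / 6"
    by (simp_all add: b4 b6 b8 b10 b14 fact_numeral)
qed

lemma Eis_eq_sigma_series:
  "Eis k = 1 - fps_const (of_real (2 * real k / bernoulli k)) * sigma_series (k - 1)"
  unfolding Eis_def sigma_series_def ..

lemma Eis_values:
  "Eis 4 = 1 + fps_const 240 * sigma_series 3"
  "Eis 6 = 1 + fps_const (- 504) * sigma_series 5"
  "Eis 8 = 1 + fps_const 480 * sigma_series 7"
  "Eis 10 = 1 + fps_const (- 264) * sigma_series 9"
  "Eis 14 = 1 + fps_const (- 24) * sigma_series 13"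
  by (simp_all add: Eis_eq_sigma_series bernoulli_values diff_conv_add_uminus
      flip: fps_const_neg del: add_uminus_conv_diff)

lemma mf_series_normalise:
  assumes "mf_series k (fps_const a + S)" "a * c = 1"
  shows "mf_series k (1 + fps_const c * S)"
  using mf_series_cmult[OF assms(1), of c] assms(2)
  by (simp add: ring_distribs mult.commute)

lemma mf_series_Eis_4_to_10:
  "mf_series 4 (Eis 4)" "mf_series 6 (Eis 6)" "mf_series 8 (Eis 8)" "mf_series 10 (Eis 10)"
  unfolding Eis_values
  using mf_series_normalise[OF mf_series_eisenstein_4_8(1), of 240]
    mf_series_normalise[OF mf_series_eisenstein_6_10(1), of "-504"]
    mf_series_normalise[OF mf_series_eisenstein_4_8(2), of 480]
    mf_series_normalise[OF mf_series_eisenstein_6_10(2), of "-264"]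
  by simp_all

text \<open>Five coefficients suffice because the eigenform criterion for T_2 involves nothing
  beyond q^4.\<close>

definition coeffs5 :: "complex fps \<Rightarrow> real \<Rightarrow> real \<Rightarrow> real \<Rightarrow> real \<Rightarrow> real \<Rightarrow> bool" where
  "coeffs5 F a b c d e \<longleftrightarrow> fps_nth F 0 = of_real a \<and> fps_nth F 1 = of_real b \<and> fps_nth F 2 = of_real c \<and>
     fps_nth F 3 = of_real d \<and> fps_nth F 4 = of_real e"

lemma coeffs5_mult:
  assumes "coeffs5 F a b c d e" "coeffs5 G a' b' c' d' e'"
  shows "coeffs5 (F * G) (a * a') (a * b' + b * a') (a * c' + b * b' + c * a')
     (a * d' + b * c' + c * b' + d * a') (a * e' + b * d' + c * c' + d * b' + e * a')"
  using assms unfolding coeffs5_def fps_mult_nth_small by simp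

lemma coeffs5_lincomb:
  assumes "coeffs5 F a b c d e" "coeffs5 G a' b' c' d' e'"
  shows "coeffs5 (fps_const (of_real s) * F + fps_const (of_real t) * G) (s * a + t * a') (s * b + t * b')
     (s * c + t * c') (s * d + t * d') (s * e + t * e')"
  using assms unfolding coeffs5_def by simp

lemma coeffs5_Eis:
  "coeffs5 (Eis 4) 1 240 2160 6720 17520"
  "coeffs5 (Eis 6) 1 (- 504) (- 16632) (- 122976) (- 532728)"
  "coeffs5 (Eis 8) 1 480 61920 1050240 7926240"
  "coeffs5 (Eis 10) 1 (- 264) (- 135432) (- 5196576) (- 69341448)"
  "coeffs5 (Eis 14) 1 (- 24) (- 196632) (- 38263776) (- 1610809368)"
  "coeffs5 1 1 0 0 0 0"
  unfolding coeffs5_def Eis_values by (simp_all add: sigma_series_nth)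

lemma coeffs5_Eis_4_cube: "coeffs5 (Eis 4 ^ 3) 1 720 179280 16954560 396974160"
  using coeffs5_mult[OF coeffs5_mult[OF coeffs5_Eis(1,1)] coeffs5_Eis(1)]
  by (simp add: power3_eq_cube)

lemma coeffs5_Delta1: "coeffs5 Delta1 0 1 (- 24) 252 (- 1472)"
proof -
  have "Delta1 = fps_const (of_real (1 / 1728)) * Eis 4 ^ 3 + fps_const (of_real (- 1 / 1728)) * (Eis 6 * Eis 6)"
    by (simp add: Delta1_def power2_eq_square right_diff_distrib flip: fps_const_neg)
  then show ?thesis
    using coeffs5_lincomb[OF coeffs5_Eis_4_cube coeffs5_mult[OF coeffs5_Eis(2,2)], of "1 / 1728" "- 1 / 1728"]
    by (simp del: of_real_divide of_real_minus)
qed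

lemma Delta1_eq: "fps_const 1728 * Delta1 = Eis 4 ^ 3 - Eis 6 ^ 2"
  unfolding Delta1_def by (simp flip: mult.assoc)

lemma mf_series_Delta1: "mf_series 12 Delta1"
proof -
  have "mf_series 12 (Eis 4 ^ 3)" "mf_series 12 (Eis 6 ^ 2)"
    using mf_series_power[OF mf_series_Eis_4_to_10(1), of 3] mf_series_power[OF mf_series_Eis_4_to_10(2), of 2]
    by simp_all
  then show ?thesis
    unfolding Delta1_def by (intro mf_series_cmult mf_series_diff)
qed

lemma Delta1_neq_0: "Delta1 \<noteq> 0"
  using coeffs5_Delta1 by (auto simp: coeffs5_def)

lemma Delta1_eq_fps_X_mult: "Delta1 = fps_X * fps_shift 1 Delta1"
proof (rule fps_ext)
  show "fps_nth Delta1 n = fps_nth (fps_X * fps_shift 1 Delta1) n" for n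
    using coeffs5_Delta1 by (cases n) (auto simp: coeffs5_def)
qed

lemma Delta1_power_eq: "Delta1 ^ m = fps_X ^ m * fps_shift 1 Delta1 ^ m"
  by (subst Delta1_eq_fps_X_mult) (rule power_mult_distrib)

lemma Eis_nth_0: "fps_nth (Eis 4) 0 = 1" "fps_nth (Eis 6) 0 = 1"
  using coeffs5_Eis(1,2) by (auto simp: coeffs5_def)

text \<open>
  For \<open>f\<close> of weight \<open>12 m + 2\<close> and order at least \<open>m\<close>, the bound gives
  \<open>E\<^sub>4 f = c \<Delta>\<^sup>m E\<^sub>6\<close>. Squaring shows that \<open>E\<^sub>4\<^sup>2\<close> times a form of weight \<open>24 m + 4\<close> is
  \<open>1728 c\<^sup>2 \<Delta>\<^sup>2\<^sup>m\<^sup>+\<^sup>1\<close>; by the bound in weight \<open>24 m + 4\<close>, this form vanishes.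
\<close>

lemma vanish_order_12m_plus_2:
  assumes m: "1 \<le> m" "m \<le> 3"
  shows "vanish_order (12 * m + 2) m"
  unfolding vanish_order_def
proof (intro allI impI)
  fix F assume F: "mf_series (12 * m + 2) F" and low: "\<forall>n<m. fps_nth F n = 0"
  define c where "c = fps_nth F m"
  define D where "D = fps_shift 1 Delta1"
  note DX = Delta1_power_eq[folded D_def]
  have D0: "fps_nth D 0 = 1" using coeffs5_Delta1 by (simp add: D_def coeffs5_def)
  have FX: "F = fps_X ^ m * fps_shift m F"
    by (rule fps_ext) (use low in \<open>simp add: fps_X_power_mult_nth\<close>)
  \<comment> \<open>The numerical bound just suffices at m = 3: 42 < 43.48 and 76 < 76.09. The
    second inequality fails at m = 4.\<close>
  have v: "vanish_order (12 * m + 6) (Suc m)" "vanish_order (24 * m + 4) (Suc (2 * m))"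
    using m by (auto intro!: vanish_order_bound)
  \<comment> \<open>Both sides are q^m times a series with constant term c, since E_4, E_6 and
    Delta1 / q start with 1.\<close>
  have "Eis 4 * F = fps_const c * (Delta1 ^ m * Eis 6)"
  proof (rule vanish_orderD[OF v(1)])
    show "mf_series (12 * m + 6) (Eis 4 * F)"
      using mf_series_mult[OF mf_series_Eis_4_to_10(1) F] by (simp add: add_ac)
    show "mf_series (12 * m + 6) (fps_const c * (Delta1 ^ m * Eis 6))"
      using mf_series_cmult[OF mf_series_mult[OF mf_series_power[OF mf_series_Delta1, of m] mf_series_Eis_4_to_10(2)], of c]
      by (simp add: mult.commute)
    have 1: "Eis 4 * F = fps_X ^ m * (Eis 4 * fps_shift m F)"
      by (subst FX) (simp add: mult_ac)
    have 2: "fps_const c * (Delta1 ^ m * Eis 6) = fps_X ^ m * (fps_const c * (D ^ m * Eis 6))"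
      unfolding DX by (simp add: mult_ac)
    show "fps_nth (Eis 4 * F) n = fps_nth (fps_const c * (Delta1 ^ m * Eis 6)) n" if "n < Suc m" for n
      unfolding 1 2 fps_X_power_mult_nth using that
      by (auto simp: less_Suc_eq Eis_nth_0 D0 fps_mult_nth_small fps_power_zeroth c_def)
  qed
  then have "(Eis 4 * F)\<^sup>2 = (fps_const c * (Delta1 ^ m * Eis 6))\<^sup>2" by simp
  then have sq: "Eis 4 ^ 2 * F ^ 2 = fps_const (c\<^sup>2) * (Delta1 ^ (2 * m) * Eis 6 ^ 2)"
    by (simp add: power_mult_distrib fps_const_power mult_ac flip: power_mult)
  \<comment> \<open>Chosen so that multiplication by E_4^2 and \<open>sq\<close> produce the factor
    E_4^3 - E_6^2, that is, one further power of Delta.\<close>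
  define G where "G = fps_const (c\<^sup>2) * (Delta1 ^ (2 * m) * Eis 4) - F ^ 2"
  have EG: "Eis 4 ^ 2 * G = fps_const (1728 * c\<^sup>2) * Delta1 ^ Suc (2 * m)"
  proof -
    have "Eis 4 ^ 2 * G = fps_const (c\<^sup>2) * (Delta1 ^ (2 * m) * (Eis 4 ^ 3 - Eis 6 ^ 2))"
      unfolding G_def right_diff_distrib sq by (simp add: power2_eq_square power3_eq_cube mult_ac)
    also have "\<dots> = (fps_const (c\<^sup>2) * fps_const 1728) * Delta1 ^ Suc (2 * m)"
      unfolding Delta1_eq[symmetric] by (simp only: power_Suc mult_ac)
    finally show ?thesis by (simp add: mult.commute)
  qed
  have "G = 0"
  proof -
    have E0: "fps_nth (Eis 4 ^ 2) 0 \<noteq> 0" by (simp add: fps_power_zeroth Eis_nth_0)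
    \<comment> \<open>E_4^2 is a unit among power series, so \<open>G\<close> inherits the order 2m
      + 1 of its product with E_4^2.\<close>
    have "G = inverse (Eis 4 ^ 2) * (Eis 4 ^ 2 * G)"
      using E0 by (simp add: inverse_mult_eq_1 flip: mult.assoc)
    also have "\<dots> = fps_X ^ Suc (2 * m) * (inverse (Eis 4 ^ 2) * fps_const (1728 * c\<^sup>2) * D ^ Suc (2 * m))"
      unfolding EG DX by (simp only: mult_ac)
    finally have G: "G = \<dots>" .
    have "mf_series (24 * m + 4) G"
      unfolding G_def
    proof (rule mf_series_diff)
      show "mf_series (24 * m + 4) (fps_const (c\<^sup>2) * (Delta1 ^ (2 * m) * Eis 4))"
        using mf_series_cmult[OF mf_series_mult[OF mf_series_power[OF mf_series_Delta1, of "2 * m"] mf_series_Eis_4_to_10(1)],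
            of "c\<^sup>2"]
        by (simp add: mult.commute)
      show "mf_series (24 * m + 4) (F ^ 2)"
      proof -
        have "24 * m + 4 = 2 * (12 * m + 2)" by simp
        then show ?thesis using mf_series_power[OF F, of 2] by (simp only:)
      qed
    qed
    moreover have "fps_nth G n = 0" if "n < Suc (2 * m)" for n
      using that by (subst G) (simp only: fps_X_power_mult_nth if_True)
    ultimately show ?thesis using v(2) unfolding vanish_order_def by blast
  qed
  with EG Delta1_neq_0 have "c = 0" by auto
  with \<open>Eis 4 * F = fps_const c * (Delta1 ^ m * Eis 6)\<close> have "Eis 4 * F = 0" by simp
  moreover have "Eis 4 \<noteq> 0" using Eis_nth_0(1) by auto
  ultimately show "F = 0" by simp
qed

text \<open>Multiplication by a nonzero form is injective and does not lower the order, so a bound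
  in the higher weight descends.\<close>

lemma vanish_order_mult:
  assumes "vanish_order (k + l) m" "mf_series l G" "G \<noteq> 0"
  shows "vanish_order k m"
  unfolding vanish_order_def
proof (intro allI impI)
  fix F assume F: "mf_series k F" "\<forall>n<m. fps_nth F n = 0"
  have "fps_nth (F * G) n = 0" if "n < m" for n
    using F(2) that by (simp add: fps_mult_nth)
  then have "F * G = 0"
    using assms(1) mf_series_mult[OF F(1) assms(2)] unfolding vanish_order_def by blast
  with assms(3) show "F = 0" by simp
qed

text \<open>Weight 14 exceeds 10.87, so one-dimensionality comes from
  \<open>vanish_order_12m_plus_2\<close> at m = 1, and the comparison is with E_4 E_10.\<close>

lemma mf_series_Eis_14: "mf_series 14 (Eis 14)"
proof -
  obtain a where a: "mf_series 14 (fps_const a + sigma_series 13)"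
    using mf_series_eisenstein[of 14] by auto
  have v: "vanish_order 14 1" using vanish_order_12m_plus_2[of 1] by simp
  have a0: "a \<noteq> 0" using eisenstein_const_neq_0[of 14 a] a v by simp

  let ?A = "fps_const a + sigma_series 13"
  have "fps_const (fps_nth ?A 0) * (Eis 4 * Eis 10) = fps_const (fps_nth (Eis 4) 0 * fps_nth (Eis 10) 0) * ?A"
    using eisenstein_const_proportional[of 4 10 "Eis 4" "Eis 10" ?A] v a mf_series_Eis_4_to_10 by simp
  then have "fps_nth (fps_const (fps_nth ?A 0) * (Eis 4 * Eis 10)) 1 =
      fps_nth (fps_const (fps_nth (Eis 4) 0 * fps_nth (Eis 10) 0) * ?A) 1"
    by (simp only:)
  \<comment> \<open>The coefficient of q in E_4 E_10 is 240 - 264.\<close>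
  then have "a * (- 24) = 1"
    using coeffs5_Eis(1,4) by (simp add: coeffs5_def sigma_series_nth)
  then show ?thesis
    unfolding Eis_values using mf_series_normalise[OF a] by simp
qed

text \<open>The numerical bound reaches weights below 21.74. Weight 26 has the form 12 m + 2, and
  weight 22 follows from it by multiplication with E_4.\<close>

lemma vanish_orders_2:
  "vanish_order 12 2" "vanish_order 16 2" "vanish_order 18 2" "vanish_order 20 2"
  "vanish_order 22 2" "vanish_order 26 2"
proof -
  show v26: "vanish_order 26 2" using vanish_order_12m_plus_2[of 2] by simp
  have "Eis 4 \<noteq> 0" using Eis_nth_0(1) by auto
  with v26 mf_series_Eis_4_to_10(1) show "vanish_order 22 2"
    using vanish_order_mult[of 22 4 2 "Eis 4"] by simp
qed (auto intro!: vanish_order_bound)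

text \<open>Here the numerical bound stops at 32.61, so 38 is treated as 12 m + 2 and 34 is deduced
  from it.\<close>

lemma vanish_orders_3:
  "vanish_order 24 3" "vanish_order 28 3" "vanish_order 30 3" "vanish_order 32 3"
  "vanish_order 34 3" "vanish_order 38 3"
proof -
  show v38: "vanish_order 38 3" using vanish_order_12m_plus_2[of 3] by simp
  have "Eis 4 \<noteq> 0" using Eis_nth_0(1) by auto
  with v38 mf_series_Eis_4_to_10(1) show "vanish_order 34 3"
    using vanish_order_mult[of 34 4 3 "Eis 4"] by simp
qed (auto intro!: vanish_order_bound)

section \<open>The sets of quotients by Delta\<close>

lemma P_eq_image: "P k = (\<lambda>F. F / Delta1) ` primitive_forms k"
  by (auto simp: P_def)

lemma P_dim_1:
  assumes v: "vanish_order (12 + w) 2" and M: "mf_series w M" "coeffs5 M 1 m1 m2 m3 m4"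
  shows "P (int (12 + w)) = {M}"
proof -
  have "primitive_forms (int (12 + w)) = {Delta1 * M}"
    using mf_series_mult[OF mf_series_Delta1 M(1)] coeffs5_mult[OF coeffs5_Delta1 M(2)]
    by (intro primitive_forms_dim_1 v) (auto simp: coeffs5_def)
  then show ?thesis
    using Delta1_neq_0 by (simp add: P_eq_image)
qed

text \<open>Normalised cusp forms of weight 24 + w are Delta1 M (E_4^3 + t Delta1) for a parameter
  t. The criterion of \<open>primitive_forms_dim_2\<close> is a monic quadratic equation in t, and
  the hypotheses on \<open>t1\<close> and \<open>t2\<close> are Vieta's formulas for its
  roots.\<close>

lemma P_dim_2:
  assumes v: "vanish_order (24 + w) 3" and M: "mf_series w M"
    and p: "coeffs5 (Delta1 * M * Eis 4 ^ 3) 0 1 p2 p3 p4"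
    and q: "coeffs5 (Delta1 * M * Delta1) 0 0 1 q3 q4"
    and t: "t1 + t2 = q4 - 2 * p2" "t1 * t2 = p2\<^sup>2 - p4 - 2 ^ (23 + w)"
  shows "P (int (24 + w)) = {M * (Eis 4 ^ 3 + rconst t1 * Delta1), M * (Eis 4 ^ 3 + rconst t2 * Delta1)}"
proof -
  define U where "U t = Delta1 * (M * (Eis 4 ^ 3 + fps_const t * Delta1))" for t
  have U: "U t = Delta1 * M * Eis 4 ^ 3 + fps_const t * (Delta1 * M * Delta1)" for t
    by (simp add: U_def algebra_simps)
  have Unth: "fps_nth (U t) 0 = 0" "fps_nth (U t) 1 = 1" "fps_nth (U t) 2 = of_real p2 + t"
    "fps_nth (U t) 4 = of_real p4 + t * of_real q4" for t
    using p q unfolding coeffs5_def U fps_add_nth fps_mult_left_const_nth by (simp_all only:) simp_all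
  have mfU: "mf_series (24 + w) (U t)" for t
    unfolding U
  proof (rule mf_series_add)
    show "mf_series (24 + w) (Delta1 * M * Eis 4 ^ 3)"
      using mf_series_mult[OF mf_series_mult[OF mf_series_Delta1 M] mf_series_power[OF mf_series_Eis_4_to_10(1), of 3]]
      by (simp add: add_ac)
    show "mf_series (24 + w) (fps_const t * (Delta1 * M * Delta1))"
      using mf_series_cmult[OF mf_series_mult[OF mf_series_mult[OF mf_series_Delta1 M] mf_series_Delta1]]
      by (simp add: add_ac)
  qed
  have Uprim: "U t \<in> primitive_forms (int (24 + w)) \<longleftrightarrow> t = of_real t1 \<or> t = of_real t2" for t
  proof -
    have "U t \<in> primitive_forms (int (24 + w)) \<longleftrightarrow>
        of_real p4 + t * of_real q4 + 2 ^ (23 + w) = (of_real p2 + t)\<^sup>2"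
      using primitive_forms_dim_2[OF _ v mfU[of t]] Unth by simp
    also have "\<dots> \<longleftrightarrow> t\<^sup>2 - of_real (q4 - 2 * p2) * t + of_real (p2\<^sup>2 - p4 - 2 ^ (23 + w)) = 0"
      by (auto simp: power2_eq_square algebra_simps)
    also have "t\<^sup>2 - of_real (q4 - 2 * p2) * t + of_real (p2\<^sup>2 - p4 - 2 ^ (23 + w)) =
        (t - of_real t1) * (t - of_real t2)"
      unfolding t[symmetric] by (simp add: power2_eq_square algebra_simps)
    finally show ?thesis by simp
  qed
  have "F \<in> range U" if "F \<in> primitive_forms (int (24 + w))" for F
  proof -
    have F: "mf_series (24 + w) F" "fps_nth F 0 = 0" "fps_nth F 1 = 1"
      using that primitive_forms_iff[of "24 + w" F] by simp_all
    \<comment> \<open>The parameter is read off at q^2, where Delta1 M Delta1 has coefficient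
      1.\<close>
    have "F = U (fps_nth F 2 - of_real p2)"
    proof (rule vanish_orderD[OF v F(1) mfU])
      fix n :: nat assume "n < 3"
      then have "n = 0 \<or> n = 1 \<or> n = 2" by auto
      then show "fps_nth F n = fps_nth (U (fps_nth F 2 - of_real p2)) n"
        using F Unth by auto
    qed
    then show ?thesis by blast
  qed
  then have "primitive_forms (int (24 + w)) = {U t | t. U t \<in> primitive_forms (int (24 + w))}"
    by auto
  also have "\<dots> = {U (of_real t1), U (of_real t2)}" unfolding Uprim by auto
  finally have "primitive_forms (int (24 + w)) = {U (of_real t1), U (of_real t2)}" .
  then have "P (int (24 + w)) = {U (of_real t1) / Delta1, U (of_real t2) / Delta1}"
    unfolding P_eq_image by simp
  moreover have "U t / Delta1 = M * (Eis 4 ^ 3 + fps_const t * Delta1)" for t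
    unfolding U_def using Delta1_neq_0 by simp
  ultimately show ?thesis by simp
qed

text \<open>For the roots a (b + sqrt N) and a (b - sqrt N) the square root cancels from sum and
  product, so each weight reduces to two numerical identities.\<close>

lemma P_dim_2_sqrt:
  assumes v: "vanish_order (24 + w) 3" and M: "mf_series w M"
    and p: "coeffs5 (Delta1 * M * Eis 4 ^ 3) 0 1 p2 p3 p4"
    and q: "coeffs5 (Delta1 * M * Delta1) 0 0 1 q3 q4"
    and N: "N \<ge> 0" and t: "2 * (a * b) = q4 - 2 * p2" "a\<^sup>2 * (b\<^sup>2 - N) = p2\<^sup>2 - p4 - 2 ^ (23 + w)"
  shows "P (int (24 + w)) = {M * (Eis 4 ^ 3 + rconst (a * (b + sqrt N)) * Delta1),
                              M * (Eis 4 ^ 3 + rconst (a * (b - sqrt N)) * Delta1)}"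
proof (rule P_dim_2[OF v M p q])
  show "a * (b + sqrt N) + a * (b - sqrt N) = q4 - 2 * p2"
    unfolding t(1)[symmetric] by (simp add: algebra_simps)
  have "a * (b + sqrt N) * (a * (b - sqrt N)) = a\<^sup>2 * (b\<^sup>2 - (sqrt N)\<^sup>2)"
    by (simp add: power2_eq_square algebra_simps)
  then show "a * (b + sqrt N) * (a * (b - sqrt N)) = p2\<^sup>2 - p4 - 2 ^ (23 + w)"
    using N t(2) by simp
qed

lemma rconst_mult_12_Delta1:
  "E - rconst x * (12 * Delta1) = E + rconst (- 12 * x) * Delta1"
  "E + rconst x * (12 * Delta1) = E + rconst (12 * x) * Delta1"
proof -
  have 12: "(12 :: complex fps) = fps_const 12" by (simp add: numeral_fps_const)
  show "E - rconst x * (12 * Delta1) = E + rconst (- 12 * x) * Delta1"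
    "E + rconst x * (12 * Delta1) = E + rconst (12 * x) * Delta1"
    unfolding 12 by (simp_all flip: mult.assoc fps_const_neg add: mult.commute)
qed

theorem proposition5:
  fixes d :: "complex fps"
  assumes "d = 12 * Delta1"
  shows "P 12 = {1} \<and>
    P 16 = {Eis 4} \<and>
    P 18 = {Eis 6} \<and>
    P 20 = {Eis 8} \<and>
    P 22 = {Eis 10} \<and>
    P 26 = {Eis 14} \<and>
    P 24 = {Eis 4 ^ 3 - rconst (13 + sqrt 144169) * d,
             Eis 4 ^ 3 - rconst (13 - sqrt 144169) * d} \<and>
    P 28 = {Eis 4 * (Eis 4 ^ 3 - rconst (9 * (47 + sqrt 18209)) * d),
             Eis 4 * (Eis 4 ^ 3 - rconst (9 * (47 - sqrt 18209)) * d)} \<and>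
    P 30 = {Eis 6 * (Eis 4 ^ 3 + rconst (8 * (43 + sqrt 51349)) * d),
             Eis 6 * (Eis 4 ^ 3 + rconst (8 * (43 - sqrt 51349)) * d)} \<and>
    P 32 = {Eis 8 * (Eis 4 ^ 3 + rconst (1567 + sqrt 18295489) * d),
             Eis 8 * (Eis 4 ^ 3 + rconst (1567 - sqrt 18295489) * d)} \<and>
    P 34 = {Eis 10 * (Eis 4 ^ 3 - rconst (6 * (851 + sqrt 2356201)) * d),
             Eis 10 * (Eis 4 ^ 3 - rconst (6 * (851 - sqrt 2356201)) * d)} \<and>
    P 38 = {Eis 14 * (Eis 4 ^ 3 - rconst (4 * (2039 + sqrt 63737521)) * d),
             Eis 14 * (Eis 4 ^ 3 - rconst (4 * (2039 - sqrt 63737521)) * d)}"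
proof (intro conjI)
  note mf = mf_series_const[of 1, simplified] mf_series_Eis_4_to_10 mf_series_Eis_14
  note E = coeffs5_Eis
  note v1 = vanish_orders_2 and v2 = vanish_orders_3
  show "P 12 = {1}" using P_dim_1[OF _ mf(1) E(6)] v1 by simp
  show "P 16 = {Eis 4}" using P_dim_1[OF _ mf(2) E(1)] v1 by simp
  show "P 18 = {Eis 6}" using P_dim_1[OF _ mf(3) E(2)] v1 by simp
  show "P 20 = {Eis 8}" using P_dim_1[OF _ mf(4) E(3)] v1 by simp
  show "P 22 = {Eis 10}" using P_dim_1[OF _ mf(5) E(4)] v1 by simp
  show "P 26 = {Eis 14}" using P_dim_1[OF _ mf(6) E(5)] v1 by simp
  \<comment> \<open>The middle factor M is left open in both facts, to be filled by 1 or an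
    Eisenstein series in each weight.\<close>
  note p = coeffs5_mult[OF coeffs5_mult[OF coeffs5_Delta1] coeffs5_Eis_4_cube]
    and q = coeffs5_mult[OF coeffs5_mult[OF coeffs5_Delta1] coeffs5_Delta1]
  note d = assms rconst_mult_12_Delta1 mult.assoc[symmetric, of "_ :: real"]
  have "coeffs5 (Delta1 * 1 * Eis 4 ^ 3) 0 1 696 162252 12831808"
    "coeffs5 (Delta1 * 1 * Delta1) 0 0 1 (- 48) 1080"
    using p[OF E(6)] q[OF E(6)] by simp_all
  \<comment> \<open>The value of \<open>a\<close> collects the 12 from d = 12 \<open>Delta1\<close>,
    the sign before d and any outer integer factor. Here the identities are 2 a b = -312 = 1080 - 2
    * 696 and 144 (13^2 - 144169) = 696^2 - 12831808 - 2^23.\<close>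
  from P_dim_2_sqrt[OF _ mf(1) this, of 144169 "- 12" 13] v2(1)
  show "P 24 = {Eis 4 ^ 3 - rconst (13 + sqrt 144169) * d,
             Eis 4 ^ 3 - rconst (13 - sqrt 144169) * d}"
    unfolding d by simp
  have "coeffs5 (Delta1 * Eis 4 * Eis 4 ^ 3) 0 1 936 331452 53282368"
    "coeffs5 (Delta1 * Eis 4 * Delta1) 0 0 1 192 (- 8280)"
    using p[OF E(1)] q[OF E(1)] by simp_all
  from P_dim_2_sqrt[OF _ mf(2) this, of 18209 "- 12 * 9" 47] v2(2)
  show "P 28 = {Eis 4 * (Eis 4 ^ 3 - rconst (9 * (47 + sqrt 18209)) * d),
             Eis 4 * (Eis 4 ^ 3 - rconst (9 * (47 - sqrt 18209)) * d)}"
    unfolding d by simp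
  have "coeffs5 (Delta1 * Eis 6 * Eis 4 ^ 3) 0 1 192 (- 205164) (- 80642048)"
    "coeffs5 (Delta1 * Eis 6 * Delta1) 0 0 1 (- 552) 8640"
    using p[OF E(2)] q[OF E(2)] by simp_all
  from P_dim_2_sqrt[OF _ mf(3) this, of 51349 "12 * 8" 43] v2(3)
  show "P 30 = {Eis 6 * (Eis 4 ^ 3 + rconst (8 * (43 + sqrt 51349)) * d),
             Eis 6 * (Eis 4 ^ 3 + rconst (8 * (43 - sqrt 51349)) * d)}"
    unfolding d by simp
  have "coeffs5 (Delta1 * Eis 8 * Eis 4 ^ 3) 0 1 1176 558252 134859328"
    "coeffs5 (Delta1 * Eis 8 * Delta1) 0 0 1 432 39960"
    using p[OF E(3)] q[OF E(3)] by simp_all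
  from P_dim_2_sqrt[OF _ mf(4) this, of 18295489 "12" 1567] v2(4)
  show "P 32 = {Eis 8 * (Eis 4 ^ 3 + rconst (1567 + sqrt 18295489) * d),
             Eis 8 * (Eis 4 ^ 3 + rconst (1567 - sqrt 18295489) * d)}"
    unfolding d by simp
  have "coeffs5 (Delta1 * Eis 10 * Eis 4 ^ 3) 0 1 432 (- 156924) (- 129459968)"
    "coeffs5 (Delta1 * Eis 10 * Delta1) 0 0 1 (- 312) (- 121680)"
    using p[OF E(4)] q[OF E(4)] by simp_all
  from P_dim_2_sqrt[OF _ mf(5) this, of 2356201 "- 12 * 6" 851] v2(5)
  show "P 34 = {Eis 10 * (Eis 4 ^ 3 - rconst (6 * (851 + sqrt 2356201)) * d),
             Eis 10 * (Eis 4 ^ 3 - rconst (6 * (851 - sqrt 2356201)) * d)}"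
    unfolding d by simp
  have "coeffs5 (Delta1 * Eis 14 * Eis 4 ^ 3) 0 1 672 (- 51084) (- 166181888)"
    "coeffs5 (Delta1 * Eis 14 * Delta1) 0 0 1 (- 72) (- 194400)"
    using p[OF E(5)] q[OF E(5)] by simp_all
  from P_dim_2_sqrt[OF _ mf(6) this, of 63737521 "- 12 * 4" 2039] v2(6)
  show "P 38 = {Eis 14 * (Eis 4 ^ 3 - rconst (4 * (2039 + sqrt 63737521)) * d),
             Eis 14 * (Eis 4 ^ 3 - rconst (4 * (2039 - sqrt 63737521)) * d)}"
    unfolding d by simp
qed

end
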